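(* For an instance $\mathcal{I}$ (basic version, as in the context), deciding whether there exists a balanced feasible assignment can be done in time polynomial in the size of the input. Moreover, when such an assignment exists, a balanced feasible assignment that is periodic with period $q$ can be computed (given by a description from which its values can be obtained) in polynomial time as well.
   Context: An instance $\mathcal{I}$ consists of a positive integer $n$, $n$ intervals $[s_i,e_i)\subseteq(-1,1)$, $i\in[n]=\{1,\dots,n\}$ (called tasks), with $e_i\in(0,1]$ and $e_i-s_i\le 1$, and a positive integer $q$ (the number of workers, given in binary; the workers are identified with $[q]$). For $r\in\mathbb{Z}_{>0}$, the $r$th occurrence of task $i$ occupies the time interval $[s_i+r,e_i+r)$. An assignment is a map $f:[n]\times\mathbb{Z}_{>0}\to[q]$. It is feasible if for all $i\neq i'$ in $[n]$ and all $r,r'\in\mathbb{Z}_{>0}$, $[s_i+r,e_i+r)\cap[s_{i'}+r',e_{i'}+r')\neq\varnothing$ implies $f(i,r)\neq f(i',r')$. It is balanced if for every $i\in[n]$ and $j\in[q]$ the limit $\lim_{t\to\infty}\frac1t\,|\{r\in[t]: f(i,r)=j\}|$ exists and equals $1/q$. It is periodic with period $h\in\mathbb{Z}_{>0}$ if $f(i,r)=f(i,r+h)$ for all $i,r$. Since $q$ is part of the input as a number, the output is not allowed to have size $\Omega(q)$. *)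

theory Defs
  imports Complex_Main "HOL-Library.Log_Nat" "HOL-Computational_Algebra.Polynomial"
begin

record task_instance =
  ntasks :: nat
  start :: "nat \<Rightarrow> rat"
  finish :: "nat \<Rightarrow> rat"
  workers :: nat

text \<open>Endpoints are rational, since an instance is the input of an algorithm; the time line
  itself is real. Tasks, workers and occurrences are numbered from 1; the values of \<open>start\<close>,
  \<open>finish\<close> and of an assignment outside these index ranges are irrelevant.\<close>

definition task_interval :: "task_instance \<Rightarrow> nat \<Rightarrow> real set" where
  "task_interval I i = {of_rat (start I i) ..< of_rat (finish I i)}"

definition occurrence :: "task_instance \<Rightarrow> nat \<Rightarrow> nat \<Rightarrow> real set" where
  "occurrence I i r = {of_rat (start I i) + real r ..< of_rat (finish I i) + real r}"

definition is_instance :: "task_instance \<Rightarrow> bool" where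
  "is_instance I \<longleftrightarrow> ntasks I > 0 \<and> workers I > 0 \<and>
     (\<forall>i\<in>{1..ntasks I}. task_interval I i \<noteq> {} \<and> task_interval I i \<subseteq> {-1<..<1} \<and>
        0 < finish I i \<and> finish I i \<le> 1 \<and> finish I i - start I i \<le> 1)"

definition is_assignment :: "task_instance \<Rightarrow> (nat \<Rightarrow> nat \<Rightarrow> nat) \<Rightarrow> bool" where
  "is_assignment I f \<longleftrightarrow> (\<forall>i\<in>{1..ntasks I}. \<forall>r\<ge>1. f i r \<in> {1..workers I})"

definition feasible :: "task_instance \<Rightarrow> (nat \<Rightarrow> nat \<Rightarrow> nat) \<Rightarrow> bool" where
  "feasible I f \<longleftrightarrow> (\<forall>i\<in>{1..ntasks I}. \<forall>i'\<in>{1..ntasks I}. i \<noteq> i' \<longrightarrow>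
     (\<forall>r\<ge>1. \<forall>r'\<ge>1. occurrence I i r \<inter> occurrence I i' r' \<noteq> {} \<longrightarrow> f i r \<noteq> f i' r'))"

definition balanced :: "task_instance \<Rightarrow> (nat \<Rightarrow> nat \<Rightarrow> nat) \<Rightarrow> bool" where
  "balanced I f \<longleftrightarrow> (\<forall>i\<in>{1..ntasks I}. \<forall>j\<in>{1..workers I}.
     (\<lambda>t. real (card {r\<in>{1..t}. f i r = j}) / real t) \<longlonglongrightarrow> 1 / real (workers I))"

definition periodic :: "task_instance \<Rightarrow> (nat \<Rightarrow> nat \<Rightarrow> nat) \<Rightarrow> nat \<Rightarrow> bool" where
  "periodic I f h \<longleftrightarrow> h > 0 \<and> (\<forall>i\<in>{1..ntasks I}. \<forall>r\<ge>1. f i r = f i (r + h))"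

definition balanced_feasible_assignment :: "task_instance \<Rightarrow> (nat \<Rightarrow> nat \<Rightarrow> nat) \<Rightarrow> bool" where
  "balanced_feasible_assignment I f \<longleftrightarrow> is_assignment I f \<and> feasible I f \<and> balanced I f"

text \<open>Model of computation: a variable-free while language in the style of Backus' FP, working on
  binary trees whose leaves are integers. Costs are logarithmic: an elementary operation is charged
  the bit sizes of its argument and of its result. Every elementary operation can be carried out by
  a Turing machine in time polynomial in this charge, and no value occurring in a run is larger
  than the cost of the run. Conversely a Turing machine step is a bounded number of elementary
  operations on an encoded configuration. Hence polynomial time here agrees with polynomial time
  on Turing machines.\<close>

datatype data = Num int | Join data data

primrec bitsize :: "data \<Rightarrow> nat" where
  "bitsize (Num k) = 1 + floorlog 2 (nat \<bar>k\<bar>)"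
| "bitsize (Join x y) = 1 + bitsize x + bitsize y"

datatype elem_op = Ident | Lit int | Left | Right | IsNum | Add | Sub | Mul | Div | Leq

fun apply_op :: "elem_op \<Rightarrow> data \<Rightarrow> data option" where
  "apply_op Ident x = Some x"
| "apply_op (Lit k) x = Some (Num k)"
| "apply_op Left (Join x y) = Some x"
| "apply_op Right (Join x y) = Some y"
| "apply_op IsNum (Num k) = Some (Num 1)"
| "apply_op IsNum (Join x y) = Some (Num 0)"
| "apply_op Add (Join (Num a) (Num b)) = Some (Num (a + b))"
| "apply_op Sub (Join (Num a) (Num b)) = Some (Num (a - b))"
| "apply_op Mul (Join (Num a) (Num b)) = Some (Num (a * b))"
| "apply_op Div (Join (Num a) (Num b)) = Some (Num (a div b))"
| "apply_op Leq (Join (Num a) (Num b)) = Some (Num (if a \<le> b then 1 else 0))"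
| "apply_op _ _ = None"

datatype prog =
    Op elem_op
  | Seq prog prog
  | Fork prog prog
  | Cond prog prog prog
  | While prog prog

text \<open>\<open>exec p x y t\<close>: on input \<open>x\<close>, program \<open>p\<close> halts with output \<open>y\<close> after time \<open>t\<close>.
  Tests count any nonzero number as true.\<close>

inductive exec :: "prog \<Rightarrow> data \<Rightarrow> data \<Rightarrow> nat \<Rightarrow> bool" where
  Op: "apply_op a x = Some y \<Longrightarrow> exec (Op a) x y (bitsize x + bitsize y)"
| Seq: "exec p x y t \<Longrightarrow> exec q y z u \<Longrightarrow> exec (Seq p q) x z (1 + t + u)"
| Fork: "exec p x y t \<Longrightarrow> exec q x z u \<Longrightarrow> exec (Fork p q) x (Join y z) (1 + t + u)"
| CondTrue: "exec b x (Num k) t \<Longrightarrow> k \<noteq> 0 \<Longrightarrow> exec p x y u \<Longrightarrow> exec (Cond b p q) x y (1 + t + u)"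
| CondFalse: "exec b x (Num 0) t \<Longrightarrow> exec q x y u \<Longrightarrow> exec (Cond b p q) x y (1 + t + u)"
| WhileFalse: "exec b x (Num 0) t \<Longrightarrow> exec (While b p) x x (1 + t)"
| WhileTrue: "exec b x (Num k) t \<Longrightarrow> k \<noteq> 0 \<Longrightarrow> exec p x y u \<Longrightarrow> exec (While b p) y z w
    \<Longrightarrow> exec (While b p) x z (1 + t + u + w)"

lemma exec_deterministic: "exec p x y t \<Longrightarrow> exec p x y' t' \<Longrightarrow> y' = y \<and> t' = t"
proof (induction arbitrary: y' t' rule: exec.induct)
  case Op from Op.prems Op.hyps show ?case by cases auto
next
  case Seq from Seq.prems show ?case by cases (auto dest!: Seq.IH)
next
  case Fork from Fork.prems show ?case by cases (auto dest!: Fork.IH)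
next
  case CondTrue from CondTrue.prems CondTrue.hyps(2) show ?case by cases (auto dest!: CondTrue.IH)
next
  case CondFalse from CondFalse.prems show ?case by cases (auto dest!: CondFalse.IH)
next
  case WhileFalse from WhileFalse.prems show ?case by cases (auto dest!: WhileFalse.IH)
next
  case WhileTrue from WhileTrue.prems WhileTrue.hyps(2) show ?case
    by cases (auto dest!: WhileTrue.IH)
qed

lemma exec_bitsize_le_time: "exec p x y t \<Longrightarrow> bitsize x \<le> t \<and> bitsize y \<le> t"
  by (induction rule: exec.induct) auto

definition halts_within :: "prog \<Rightarrow> data \<Rightarrow> data \<Rightarrow> nat \<Rightarrow> bool" where
  "halts_within p x y b \<longleftrightarrow> (\<exists>t\<le>b. exec p x y t)"

primrec encode_list :: "data list \<Rightarrow> data" where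
  "encode_list [] = Num 0"
| "encode_list (x # xs) = Join x (encode_list xs)"

definition encode_rat :: "rat \<Rightarrow> data" where
  "encode_rat x = Join (Num (fst (quotient_of x))) (Num (snd (quotient_of x)))"

definition encode_instance :: "task_instance \<Rightarrow> data" where
  "encode_instance I = Join (Num (int (ntasks I))) (Join (Num (int (workers I)))
     (encode_list (map (\<lambda>i. Join (encode_rat (start I i)) (encode_rat (finish I i)))
        [1..<Suc (ntasks I)])))"

end

theory Submission
  imports Defs
begin

text \<open>If integers \<open>k i\<close> are such that the intervals \<open>[s i + k i, e i + k i)\<close> are pairwise disjoint modulo
  \<open>q\<close>, then \<open>f i r = 1 + (r - k i) mod q\<close> is a balanced feasible assignment of period \<open>q\<close>: all workers
  follow the same closed schedule of length \<open>q\<close>, each one unit of time behind the previous one. To find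
  such a schedule, take the endpoints modulo 1 as vertices and the tasks as arcs, and fill up the load
  to \<open>q\<close> everywhere with idle arcs between consecutive endpoints. All cells of the circle are then covered
  equally often, so in-degrees equal out-degrees, and if the graph is connected an Eulerian tour is a
  schedule as wanted. Conversely, a worker can never leave a connected component, whence balance
  forces connectedness.\<close>

section \<open>Polynomial-time functions on encodable types\<close>

text \<open>Capping the load at \<open>n + 1\<close> when \<open>q\<close> is larger does not affect
  connectedness: at most \<open>n\<close> tasks cover a cell, so every cell with load below
  \<open>q\<close> still carries an idle arc. The capped arcs have total length at most
  \<open>D * q\<close>, where \<open>D\<close> is the scaled unit of time, so a tour through all of
  them still fits into a closed schedule of length \<open>q\<close>.

  Connectedness gets no test of its own: the tour grows from one arc, and what it leaves over shows
  whether there is another component. For the converse, each cell of the circle is classified by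
  whether the last endpoint at or before it lies on the tour. Neither performing a task nor being
  idle can change the class in which a worker is, whereas a positive frequency \<open>1 / q\<close>
  forces worker 1 to perform every task at some time.

  The integers \<open>k i\<close> arise since consecutive arcs of a tour match modulo 1: when the
  tour is unrolled onto the line, each task begins at its own start plus an integer.\<close>

lemma poly_nat_mono:
  fixes P :: "nat poly"
  assumes "m \<le> n"
  shows "poly P m \<le> poly P n"
  using assms by (induction P) (auto intro: add_mono mult_mono)

text \<open>Codes need not be injective across types: \<open>[]\<close>, \<open>False\<close> and
  \<open>0\<close> share one, and a nonempty list has the code of the pair of its head and tail. The
  type decides how a tree is read.\<close>

class encodable =
  fixes enc :: "'a \<Rightarrow> data"

instantiation int :: encodable
begin
definition "enc k = Num k"
instance ..
end

instantiation bool :: encodable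
begin
definition "enc b = Num (if b then 1 else 0)"
instance ..
end

instantiation prod :: (encodable, encodable) encodable
begin
definition "enc p = Join (enc (fst p)) (enc (snd p))"
instance ..
end

instantiation list :: (encodable) encodable
begin
definition "enc xs = encode_list (map enc xs)"
instance ..
end

lemmas enc_defs = enc_int_def enc_bool_def enc_prod_def enc_list_def

definition esize :: "'a::encodable \<Rightarrow> nat" where
  "esize x = bitsize (enc x)"

lemma esize_int: "esize (k::int) = 1 + floorlog 2 (nat \<bar>k\<bar>)"
  by (simp add: esize_def enc_int_def)

lemma esize_bool: "esize (b::bool) \<le> 2"
  by (simp add: esize_def enc_bool_def floorlog_def)

lemma esize_prod: "esize p = 1 + esize (fst p) + esize (snd p)"
  by (simp add: esize_def enc_prod_def)

lemma esize_Nil [simp]: "esize [] = 1"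
  by (simp add: esize_def enc_list_def floorlog_def)

lemma esize_Cons [simp]: "esize (x # xs) = 1 + esize x + esize xs"
  by (simp add: esize_def enc_list_def)

lemma esize_Pair [simp]: "esize (x, y) = 1 + esize x + esize y"
  by (simp add: esize_prod)

lemma esize_append: "esize (xs @ ys) + 1 = esize xs + esize ys"
  by (induction xs) auto

lemma length_less_esize: "length xs < esize xs"
  by (induction xs) auto

text \<open>The program must halt with the right value on every element of the type, not just on
  codes of instances. The functions of the algorithm are therefore total, with defaults such as
  \<open>x div 0 = 0\<close>, and the closure rules carry no conditions on the domain.\<close>

definition ptime :: "('a::encodable \<Rightarrow> 'b::encodable) \<Rightarrow> bool" where
  "ptime f \<longleftrightarrow> (\<exists>p (P::nat poly). \<forall>x. halts_within p (enc x) (enc (f x)) (poly P (esize x)))"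

text \<open>A run costs at least the size of its output, so the polynomial that bounds the time also
  bounds the size of the result.\<close>

lemma ptimeE:
  assumes "ptime f"
  obtains p and P :: "nat poly" where
    "\<And>x. \<exists>t \<le> poly P (esize x). exec p (enc x) (enc (f x)) t"
    "\<And>x. esize (f x) \<le> poly P (esize x)"
proof -
  from assms obtain p and P :: "nat poly" where
    *: "\<And>x. \<exists>t \<le> poly P (esize x). exec p (enc x) (enc (f x)) t"
    unfolding ptime_def halts_within_def by blast
  moreover have "esize (f x) \<le> poly P (esize x)" for x
    using *[of x] exec_bitsize_le_time unfolding esize_def by (meson le_trans)
  ultimately show ?thesis using that by blast
qed

lemma ptimeI:
  assumes "\<And>x. \<exists>t \<le> poly (P::nat poly) (esize x). exec p (enc x) (enc (f x)) t"
  shows "ptime f"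
  using assms unfolding ptime_def halts_within_def by blast

lemmas exec_intros = exec.Seq[simplified] exec.Fork[simplified] exec.CondTrue[simplified]
  exec.CondFalse[simplified] exec.WhileFalse[simplified] exec.WhileTrue[simplified]

lemma ptime_comp:
  assumes "ptime f" "ptime g"
  shows "ptime (\<lambda>x. f (g x))"
proof -
  obtain p P where p: "\<And>x. \<exists>t \<le> poly P (esize x). exec p (enc x) (enc (f x)) t"
    using ptimeE[OF assms(1)] by metis
  obtain q Q where q: "\<And>x. \<exists>t \<le> poly Q (esize x). exec q (enc x) (enc (g x)) t"
    "\<And>x. esize (g x) \<le> poly Q (esize x)"
    using ptimeE[OF assms(2)] by metis
  show ?thesis
  proof (rule ptimeI)
    fix x
    obtain t u where tu: "t \<le> poly Q (esize x)" "exec q (enc x) (enc (g x)) t"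
      "u \<le> poly P (esize (g x))" "exec p (enc (g x)) (enc (f (g x))) u"
      using p q by metis
    have "u \<le> poly P (poly Q (esize x))"
      using tu(3) q(2) poly_nat_mono le_trans by blast
    with tu show "\<exists>t \<le> poly (1 + Q + pcompose P Q) (esize x).
        exec (Seq q p) (enc x) (enc (f (g x))) t"
      by (intro exI[of _ "1 + t + u"]) (auto simp: poly_pcompose intro: exec_intros)
  qed
qed

named_theorems ptime_intros

lemma ptime_pair [ptime_intros]:
  assumes "ptime f" "ptime g"
  shows "ptime (\<lambda>x. (f x, g x))"
proof -
  obtain p P where p: "\<And>x. \<exists>t \<le> poly P (esize x). exec p (enc x) (enc (f x)) t"
    using ptimeE[OF assms(1)] by metis
  obtain q Q where q: "\<And>x. \<exists>t \<le> poly Q (esize x). exec q (enc x) (enc (g x)) t"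
    using ptimeE[OF assms(2)] by metis
  show ?thesis
  proof (rule ptimeI)
    fix x
    obtain t u where "t \<le> poly P (esize x)" "exec p (enc x) (enc (f x)) t"
      "u \<le> poly Q (esize x)" "exec q (enc x) (enc (g x)) u"
      using p q by metis
    then show "\<exists>t \<le> poly (1 + P + Q) (esize x). exec (Fork p q) (enc x) (enc (f x, g x)) t"
      by (intro exI[of _ "1 + t + u"]) (auto simp: enc_prod_def intro: exec_intros)
  qed
qed

lemma ptime_comp2:
  assumes "ptime (\<lambda>p. h (fst p) (snd p))" "ptime f" "ptime g"
  shows "ptime (\<lambda>x. h (f x) (g x))"
  using ptime_comp[OF assms(1) ptime_pair[OF assms(2,3)]] by simp

lemma ptime_comp3:
  assumes "ptime (\<lambda>p. h (fst p) (fst (snd p)) (snd (snd p)))" "ptime f" "ptime g" "ptime k"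
  shows "ptime (\<lambda>x. h (f x) (g x) (k x))"
  using ptime_comp[OF assms(1) ptime_pair[OF assms(2) ptime_pair[OF assms(3,4)]]] by simp

lemma ptime_OpI:
  assumes "\<And>x. apply_op a (enc x) = Some (enc (f x))" "\<And>x. esize (f x) \<le> poly B (esize x)"
  shows "ptime f"
proof (rule ptimeI)
  fix x
  show "\<exists>t \<le> poly ([:0, 1:] + B) (esize x). exec (Op a) (enc x) (enc (f x)) t"
    using exec.Op[OF assms(1)[of x]] assms(2)[of x]
    by (intro exI[of _ "esize x + esize (f x)"]) (auto simp: esize_def)
qed

lemma ptime_id [ptime_intros]: "ptime (\<lambda>x. x)"
  by (rule ptime_OpI[where a = Ident and B = "[:0, 1:]"]) auto

lemma ptime_fst [ptime_intros]: "ptime f \<Longrightarrow> ptime (\<lambda>x. fst (f x))"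
  by (rule ptime_comp[where f = fst], rule ptime_OpI[where a = Left and B = "[:0, 1:]"])
    (auto simp: enc_prod_def)

lemma ptime_snd [ptime_intros]: "ptime f \<Longrightarrow> ptime (\<lambda>x. snd (f x))"
  by (rule ptime_comp[where f = snd], rule ptime_OpI[where a = Right and B = "[:0, 1:]"])
    (auto simp: enc_prod_def)

lemma ptime_int_const [ptime_intros]: "ptime (\<lambda>x. k :: int)"
  by (rule ptime_OpI[where a = "Lit k" and B = "[:esize k:]"]) (auto simp: enc_int_def)

lemma ptime_bool_const [ptime_intros]: "ptime (\<lambda>x. b :: bool)"
  by (rule ptime_OpI[where a = "Lit (if b then 1 else 0)" and B = "[:2:]"])
    (auto simp: enc_bool_def esize_bool)

lemma ptime_Nil [ptime_intros]: "ptime (\<lambda>x. [])"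
  by (rule ptime_OpI[where a = "Lit 0" and B = "[:1:]"]) (auto simp: enc_list_def)

lemma ptime_Cons [ptime_intros]:
  assumes "ptime f" "ptime g"
  shows "ptime (\<lambda>x. f x # g x)"
proof -
  have "ptime (\<lambda>p. fst p # snd p :: 'b list)"
    by (rule ptime_OpI[where a = Ident and B = "[:0, 1:]"])
      (auto simp: enc_list_def enc_prod_def esize_prod)
  then show ?thesis by (rule ptime_comp2[OF _ assms])
qed

section \<open>Bit sizes under integer arithmetic\<close>

lemma floorlog_add: "floorlog 2 (a + b) \<le> 1 + floorlog 2 a + floorlog 2 b"
proof (rule floorlog_leI)
  have "a < 2 ^ floorlog 2 a" "b < 2 ^ floorlog 2 b"
    by (auto intro: floorlog_leD)
  moreover have "(2::nat) ^ floorlog 2 a \<le> 2 ^ (floorlog 2 a + floorlog 2 b)"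
    "(2::nat) ^ floorlog 2 b \<le> 2 ^ (floorlog 2 a + floorlog 2 b)"
    by (auto intro: power_increasing)
  ultimately have "a + b < 2 ^ (floorlog 2 a + floorlog 2 b) + 2 ^ (floorlog 2 a + floorlog 2 b)"
    by linarith
  then show "a + b < 2 ^ (1 + floorlog 2 a + floorlog 2 b)" by simp
qed auto

lemma floorlog_mult: "floorlog 2 (a * b) \<le> floorlog 2 a + floorlog 2 b"
proof (rule floorlog_leI)
  have "a < 2 ^ floorlog 2 a" "b < 2 ^ floorlog 2 b"
    by (auto intro: floorlog_leD)
  then show "a * b < 2 ^ (floorlog 2 a + floorlog 2 b)"
    by (simp add: power_add mult_strict_mono)
qed auto

lemma esize_add_int: "esize (a + b :: int) \<le> esize a + esize b"
  using floorlog_mono[of "nat \<bar>a + b\<bar>" "nat \<bar>a\<bar> + nat \<bar>b\<bar>" 2]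
    floorlog_add[of "nat \<bar>a\<bar>" "nat \<bar>b\<bar>"]
  by (simp add: esize_int nat_add_distrib[symmetric] nat_mono abs_triangle_ineq)

lemma esize_uminus_int: "esize (- a :: int) = esize a"
  by (simp add: esize_int)

lemma esize_diff_int: "esize (a - b :: int) \<le> esize a + esize b"
  using esize_add_int[of a "-b"] by (simp add: esize_uminus_int)

lemma esize_mult_int: "esize (a * b :: int) \<le> esize a + esize b"
  using floorlog_mult[of "nat \<bar>a\<bar>" "nat \<bar>b\<bar>"]
  by (simp add: esize_int abs_mult nat_mult_distrib)

text \<open>Rounding down can increase the modulus of a negative quotient, but never past that of
  \<open>a\<close> itself.\<close>

lemma abs_div_le: "\<bar>a div b\<bar> \<le> \<bar>a\<bar>" for a b :: int
proof -
  have pos: "\<bar>a div b\<bar> \<le> \<bar>a\<bar>" if "b > 0" for a b :: int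
  proof (cases "a < 0")
    case True
    then have "a div 1 \<le> a div b" "a div b < 0"
      using that zdiv_mono2_neg[of a 1 b] div_neg_pos_less0[of a b] by auto
    then show ?thesis by auto
  next
    case False
    then have "a div b \<le> a div 1" "a div b \<ge> 0"
      using that zdiv_mono2[of a 1 b] by (auto simp: pos_imp_zdiv_nonneg_iff)
    then show ?thesis by auto
  qed
  show ?thesis
    using pos[of b a] pos[of "- b" "- a"] by (cases "b > 0"; cases "b = 0") auto
qed

lemma esize_div_int: "esize (a div b :: int) \<le> esize a"
  using floorlog_mono[OF nat_mono[OF abs_div_le]] by (simp add: esize_int)

lemma ptime_add [ptime_intros]:
  assumes "ptime f" "ptime g"
  shows "ptime (\<lambda>x. f x + g x :: int)"
  by (rule ptime_comp2[OF _ assms], rule ptime_OpI[where a = Add and B = "[:0, 1:]"])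
    (use esize_add_int le_Suc_eq in \<open>auto simp: enc_prod_def enc_int_def esize_prod\<close>)

lemma ptime_diff [ptime_intros]:
  assumes "ptime f" "ptime g"
  shows "ptime (\<lambda>x. f x - g x :: int)"
  by (rule ptime_comp2[OF _ assms], rule ptime_OpI[where a = Sub and B = "[:0, 1:]"])
    (use esize_diff_int le_Suc_eq in \<open>auto simp: enc_prod_def enc_int_def esize_prod\<close>)

lemma ptime_mult [ptime_intros]:
  assumes "ptime f" "ptime g"
  shows "ptime (\<lambda>x. f x * g x :: int)"
  by (rule ptime_comp2[OF _ assms], rule ptime_OpI[where a = Mul and B = "[:0, 1:]"])
    (use esize_mult_int le_Suc_eq in \<open>auto simp: enc_prod_def enc_int_def esize_prod\<close>)

lemma ptime_div [ptime_intros]: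
  assumes "ptime f" "ptime g"
  shows "ptime (\<lambda>x. f x div g x :: int)"
proof -
  have "esize (a div b) \<le> Suc (esize a + esize b)" for a b :: int
    using esize_div_int[of a b] by simp
  then have "ptime (\<lambda>p. fst p div snd p :: int)"
    by (intro ptime_OpI[where a = Div and B = "[:0, 1:]"])
      (auto simp: enc_prod_def enc_int_def esize_prod)
  then show ?thesis by (rule ptime_comp2[OF _ assms])
qed

lemma ptime_mod [ptime_intros]:
  assumes "ptime f" "ptime g"
  shows "ptime (\<lambda>x. f x mod g x :: int)"
proof -
  have "ptime (\<lambda>x. f x - g x * (f x div g x))" by (intro ptime_intros assms)
  then show ?thesis by (simp add: minus_mult_div_eq_mod)
qed

lemma ptime_le [ptime_intros]:
  assumes "ptime f" "ptime g"
  shows "ptime (\<lambda>x. f x \<le> (g x :: int))"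
proof -
  have "ptime (\<lambda>p. fst p \<le> (snd p :: int))"
    by (rule ptime_OpI[where a = Leq and B = "[:2:]"])
      (auto simp: enc_prod_def enc_int_def enc_bool_def esize_bool)
  then show ?thesis by (rule ptime_comp2[OF _ assms])
qed

lemma ptime_if [ptime_intros]:
  assumes "ptime b" "ptime f" "ptime g"
  shows "ptime (\<lambda>x. if b x then f x else g x)"
proof -
  obtain r R where r: "\<And>x. \<exists>t \<le> poly R (esize x). exec r (enc x) (enc (b x)) t"
    using ptimeE[OF assms(1)] by metis
  obtain p P where p: "\<And>x. \<exists>t \<le> poly P (esize x). exec p (enc x) (enc (f x)) t"
    using ptimeE[OF assms(2)] by metis
  obtain q Q where q: "\<And>x. \<exists>t \<le> poly Q (esize x). exec q (enc x) (enc (g x)) t"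
    using ptimeE[OF assms(3)] by metis
  show ?thesis
  proof (rule ptimeI)
    fix x
    obtain s t u where "s \<le> poly R (esize x)" "exec r (enc x) (enc (b x)) s"
      "t \<le> poly P (esize x)" "exec p (enc x) (enc (f x)) t"
      "u \<le> poly Q (esize x)" "exec q (enc x) (enc (g x)) u"
      using p q r by metis
    then show "\<exists>t \<le> poly (1 + R + P + Q) (esize x).
        exec (Cond r p q) (enc x) (enc (if b x then f x else g x)) t"
      by (intro exI[of _ "1 + s + (if b x then t else u)"])
        (auto simp: enc_bool_def intro: exec_intros)
  qed
qed

lemma ptime_not [ptime_intros]:
  assumes "ptime f"
  shows "ptime (\<lambda>x. \<not> f x)"
proof -
  have "ptime (\<lambda>x. if f x then False else True)" by (intro ptime_intros assms)
  moreover have "(\<lambda>x. if f x then False else True) = (\<lambda>x. \<not> f x)" by auto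
  ultimately show ?thesis by simp
qed

lemma ptime_conj [ptime_intros]:
  assumes "ptime f" "ptime g"
  shows "ptime (\<lambda>x. f x \<and> g x)"
proof -
  have "ptime (\<lambda>x. if f x then g x else False)" by (intro ptime_intros assms)
  moreover have "(\<lambda>x. if f x then g x else False) = (\<lambda>x. f x \<and> g x)" by auto
  ultimately show ?thesis by simp
qed

lemma ptime_eq [ptime_intros]:
  assumes "ptime f" "ptime g"
  shows "ptime (\<lambda>x. f x = (g x :: int))"
proof -
  have "ptime (\<lambda>x. f x \<le> g x \<and> g x \<le> f x)" by (intro ptime_intros assms)
  then show ?thesis by (simp add: order_eq_iff)
qed

lemma ptime_less [ptime_intros]:
  assumes "ptime f" "ptime g"
  shows "ptime (\<lambda>x. f x < (g x :: int))"
proof -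
  have "ptime (\<lambda>x. \<not> g x \<le> f x)" by (intro ptime_intros assms)
  then show ?thesis by (simp add: not_le)
qed

text \<open>\<open>IsNum\<close> recognises the empty list, whose code is a number. The code of a
  nonempty list is already that of head and tail as a pair, so pairing it with the input yields the
  argument of \<open>g\<close> without any rearrangement.\<close>

lemma ptime_case_list [ptime_intros]:
  fixes l :: "'a::encodable \<Rightarrow> 'b::encodable list"
  assumes "ptime l" "ptime f" "ptime (\<lambda>p. g (fst p) (fst (snd p)) (snd (snd p)))"
  shows "ptime (\<lambda>x. case l x of [] \<Rightarrow> f x | y # ys \<Rightarrow> g x y ys)"
proof -
  obtain r R where r: "\<And>x. \<exists>t \<le> poly R (esize x). exec r (enc x) (enc (l x)) t"
    "\<And>x. esize (l x) \<le> poly R (esize x)"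
    using ptimeE[OF assms(1)] by metis
  obtain p P where p: "\<And>x. \<exists>t \<le> poly P (esize x). exec p (enc x) (enc (f x)) t"
    using ptimeE[OF assms(2)] by metis
  obtain q Q where q: "\<And>x. \<exists>t \<le> poly Q (esize x).
      exec q (enc x) (enc (g (fst x) (fst (snd x)) (snd (snd x)))) t"
    using ptimeE[OF assms(3)] by metis
  define b where "b = Seq r (Op IsNum)"
  have b: "\<exists>t \<le> poly (3 + 2 * R) (esize x). exec b (enc x) (Num (if l x = [] then 1 else 0)) t" for x :: 'a
  proof -
    obtain t where t: "t \<le> poly R (esize x)" "exec r (enc x) (enc (l x)) t" using r by metis
    have "apply_op IsNum (enc (l x)) = Some (Num (if l x = [] then 1 else 0))"
      by (cases "l x") (auto simp: enc_list_def)
    from exec.Seq[OF t(2) exec.Op[OF this]]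
    have "exec b (enc x) (Num (if l x = [] then 1 else 0))
        (1 + t + (esize (l x) + bitsize (Num (if l x = [] then 1 else 0))))"
      by (simp add: b_def esize_def)
    moreover have "bitsize (Num (if l x = [] then 1 else 0)) \<le> 2" by (simp add: floorlog_def)
    ultimately show ?thesis using t r(2)[of x]
      by (intro exI[of _ "1 + t + (esize (l x) + bitsize (Num (if l x = [] then 1 else 0)))"])
        (auto simp del: bitsize.simps)
  qed
  define c where "c = Seq (Fork (Op Ident) r) q"
  show ?thesis
  proof (rule ptimeI)
    fix x :: 'a
    let ?n = "esize x"
    obtain s where s: "s \<le> poly (3 + 2 * R) ?n" "exec b (enc x) (Num (if l x = [] then 1 else 0)) s"
      using b by metis
    show "\<exists>t \<le> poly (6 + [:0, 2:] + 3 * R + P + pcompose Q (1 + [:0, 1:] + R)) ?n.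
        exec (Cond b p c) (enc x) (enc (case l x of [] \<Rightarrow> f x | y # ys \<Rightarrow> g x y ys)) t"
    proof (cases "l x")
      case Nil
      obtain t where "t \<le> poly P ?n" "exec p (enc x) (enc (f x)) t" using p by metis
      with s show ?thesis
        by (intro exI[of _ "1 + s + t"]) (auto simp: Nil intro: exec_intros)
    next
      case (Cons y ys)
      obtain t where t: "t \<le> poly R ?n" "exec r (enc x) (enc (l x)) t" using r by metis
      have enc: "Join (enc x) (enc (l x)) = enc (x, y, ys)"
        by (simp add: Cons enc_list_def enc_prod_def)
      obtain u where u: "u \<le> poly Q (esize (x, y, ys))" "exec q (enc (x, y, ys)) (enc (g x y ys)) u"
        using q[of "(x, y, ys)"] by auto
      have "esize (x, y, ys) \<le> 1 + ?n + poly R ?n" using r(2)[of x] by (simp add: Cons)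
      then have u': "u \<le> poly Q (1 + ?n + poly R ?n)" using u(1) poly_nat_mono le_trans by blast
      have "exec (Op Ident) (enc x) (enc x) (?n + ?n)"
        using exec.Op[of Ident "enc x" "enc x"] by (simp add: esize_def)
      from exec.Seq[OF exec.Fork[OF this t(2)]] u(2)
      have "exec c (enc x) (enc (g x y ys)) (1 + (1 + (?n + ?n) + t) + u)"
        unfolding c_def enc by blast
      then have "exec (Cond b p c) (enc x) (enc (g x y ys)) (1 + s + (1 + (1 + (?n + ?n) + t) + u))"
        using s(2) by (intro exec.CondFalse) (simp_all add: Cons)
      with s(1) t(1) u' show ?thesis
        by (intro exI[of _ "1 + s + (1 + (1 + (?n + ?n) + t) + u)"]) (auto simp: Cons poly_pcompose)
    qed
  qed
qed

text \<open>The number of rounds and all intermediate sizes are bounded in terms of the initial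
  input. Bounding each round by its own input would not do: under repeated squaring every round is
  polynomial and the sizes still explode.\<close>

lemma ptime_while:
  fixes b :: "'a::encodable \<Rightarrow> bool" and c :: "'a \<Rightarrow> 'a"
  assumes "ptime b" "ptime c"
    and *: "\<And>x. \<exists>m \<le> poly P (esize x). (c ^^ m) x = h x \<and> \<not> b (h x) \<and> (\<forall>k<m. b ((c ^^ k) x)) \<and>
      (\<forall>k\<le>m. esize ((c ^^ k) x) \<le> poly P (esize x))"
  shows "ptime h"
proof -
  obtain p R where p: "\<And>x. \<exists>t \<le> poly R (esize x). exec p (enc x) (enc (b x)) t"
    using ptimeE[OF assms(1)] by metis
  obtain q Q where q: "\<And>x. \<exists>t \<le> poly Q (esize x). exec q (enc x) (enc (c x)) t"
    using ptimeE[OF assms(2)] by metis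
  have loop: "\<exists>t \<le> (m + 1) * (1 + poly R M + poly Q M). exec (While p q) (enc x) (enc ((c ^^ m) x)) t"
    if "\<not> b ((c ^^ m) x)" "\<forall>k<m. b ((c ^^ k) x)" "\<forall>k\<le>m. esize ((c ^^ k) x) \<le> M" for m M and x :: 'a
    using that
  proof (induction m arbitrary: x)
    case 0
    obtain t where t: "t \<le> poly R (esize x)" "exec p (enc x) (enc (b x)) t" using p by metis
    have "poly R (esize x) \<le> poly R M" using 0 by (auto intro: poly_nat_mono)
    with t 0 show ?case
      by (intro exI[of _ "1 + t"]) (auto simp: enc_bool_def intro: exec_intros)
  next
    case (Suc m)
    have x: "b x" "esize x \<le> M" using Suc.prems(2,3) by (auto dest: spec[of _ 0])
    obtain t u where t: "t \<le> poly R (esize x)" "exec p (enc x) (enc (b x)) t"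
       "u \<le> poly Q (esize x)" "exec q (enc x) (enc (c x)) u" using p q by metis
    have tu: "t \<le> poly R M" "u \<le> poly Q M"
      using t(1,3) x(2) poly_nat_mono le_trans by blast+
    have "\<exists>w \<le> (m + 1) * (1 + poly R M + poly Q M).
        exec (While p q) (enc (c x)) (enc ((c ^^ m) (c x))) w"
    proof (rule Suc.IH)
      show "\<not> b ((c ^^ m) (c x))" using Suc.prems(1) by (simp add: funpow_swap1)
      show "\<forall>k<m. b ((c ^^ k) (c x))"
      proof (intro allI impI)
        fix k assume "k < m"
        then show "b ((c ^^ k) (c x))" using Suc.prems(2) spec[of _ "Suc k"] by (auto simp: funpow_swap1)
      qed
      show "\<forall>k\<le>m. esize ((c ^^ k) (c x)) \<le> M"
      proof (intro allI impI)
        fix k assume "k \<le> m"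
        then show "esize ((c ^^ k) (c x)) \<le> M" using Suc.prems(3) spec[of _ "Suc k"] by (auto simp: funpow_swap1)
      qed
    qed
    then obtain w where w: "w \<le> (m + 1) * (1 + poly R M + poly Q M)"
      "exec (While p q) (enc (c x)) (enc ((c ^^ Suc m) x)) w"
      by (auto simp: funpow_swap1)
    have "exec p (enc x) (Num 1) t" using t(2) x(1) by (simp add: enc_bool_def)
    from exec.WhileTrue[OF this _ t(4) w(2)] tu w(1) show ?case
      by (intro exI[of _ "1 + t + u + w"]) auto
  qed
  show ?thesis
  proof (rule ptimeI)
    fix x :: 'a
    obtain m where m: "m \<le> poly P (esize x)" "(c ^^ m) x = h x" "\<not> b (h x)" "\<forall>k<m. b ((c ^^ k) x)"
      "\<forall>k\<le>m. esize ((c ^^ k) x) \<le> poly P (esize x)" using * by metis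
    let ?K = "1 + poly R (poly P (esize x)) + poly Q (poly P (esize x))"
    obtain t where t: "t \<le> (m + 1) * ?K" "exec (While p q) (enc x) (enc (h x)) t"
      using loop[OF _ m(4,5)] m(2,3) by auto
    have "(m + 1) * ?K \<le> (poly P (esize x) + 1) * ?K" using m(1) by (intro mult_right_mono) auto
    with t show "\<exists>t \<le> poly ((P + 1) * (1 + pcompose R P + pcompose Q P)) (esize x).
        exec (While p q) (enc x) (enc (h x)) t"
      by (intro exI[of _ t]) (auto simp: poly_pcompose)
  qed
qed

lemma esize_pos: "esize x > 0"
  by (cases "enc x") (auto simp: esize_def)

lemma esize_take_le: "esize (take k xs) \<le> esize xs"
  using esize_append[of "take k xs" "drop k xs"] esize_pos[of "drop k xs"] by simp

lemma esize_drop_le: "esize (drop k xs) \<le> esize xs"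
  using esize_append[of "take k xs" "drop k xs"] esize_pos[of "take k xs"] by simp

text \<open>The loop carries the parameter \<open>x\<close>, the remaining list and the accumulator.
  As \<open>B\<close> is assumed for all lists, it applies to the prefixes \<open>take k ys\<close>
  and thereby to every intermediate accumulator.\<close>

lemma ptime_fold_bounded:
  fixes l :: "'a::encodable \<Rightarrow> 'b::encodable list" and s :: "'a \<Rightarrow> 'c::encodable"
  assumes step: "ptime (\<lambda>p. h (fst p) (fst (snd p)) (snd (snd p)))"
    and "ptime l" "ptime s"
    and B: "\<And>x ys s. esize (fold (h x) ys s) \<le> poly B (esize x + esize ys + esize s)"
  shows "ptime (\<lambda>x. fold (h x) (l x) (s x))"
proof -
  let ?b = "\<lambda>p. case fst (snd p) of [] \<Rightarrow> False | y # ys \<Rightarrow> True"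
  let ?c = "\<lambda>p. case fst (snd p) of [] \<Rightarrow> p | y # ys \<Rightarrow> (fst p, ys, h (fst p) y (snd (snd p)))"
  have c: "ptime ?c"
    by (intro ptime_intros ptime_comp3[OF step])
  have b: "ptime ?b"
    by (intro ptime_intros)
  have pow: "(?c ^^ k) (x, ys, s) = (x, drop k ys, fold (h x) (take k ys) s)"
    if "k \<le> length ys" for k x ys s
    using that
  proof (induction k)
    case (Suc k)
    then have "drop k ys = ys ! k # drop (Suc k) ys" "take (Suc k) ys = take k ys @ [ys ! k]"
      by (simp_all add: Cons_nth_drop_Suc take_Suc_conv_app_nth)
    then show ?case using Suc by simp
  qed simp
  have "ptime (\<lambda>p. (fst p, [] :: 'b list, fold (h (fst p)) (fst (snd p)) (snd (snd p))))"
  proof (rule ptime_while[OF b c, where P = "2 + [:0, 2:] + B"])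
    fix p :: "'a \<times> 'b list \<times> 'c"
    obtain x ys s where p: "p = (x, ys, s)" by (cases p)
    let ?N = "poly (2 + [:0, 2:] + B) (esize p)"
    have "esize ((?c ^^ k) p) \<le> ?N" if "k \<le> length ys" for k
    proof -
      have "esize (fold (h x) (take k ys) s) \<le> poly B (esize x + esize (take k ys) + esize s)"
        by (rule B)
      also have "\<dots> \<le> poly B (esize p)"
        using esize_take_le[of k ys] by (intro poly_nat_mono) (simp add: p)
      finally show ?thesis
        using esize_drop_le[of k ys] by (simp add: p pow that)
    qed
    moreover have "length ys \<le> ?N" using length_less_esize[of ys] by (simp add: p)
    moreover have "?b ((?c ^^ k) p)" if "k < length ys" for k
      using that by (simp add: p pow split: list.split)
    moreover have "(?c ^^ length ys) p = (x, [], fold (h x) ys s)" by (simp add: p pow)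
    ultimately show "\<exists>m \<le> ?N. (?c ^^ m) p = (fst p, [], fold (h (fst p)) (fst (snd p)) (snd (snd p))) \<and>
        \<not> ?b (fst p, [], fold (h (fst p)) (fst (snd p)) (snd (snd p))) \<and> (\<forall>k<m. ?b ((?c ^^ k) p)) \<and>
        (\<forall>k\<le>m. esize ((?c ^^ k) p) \<le> ?N)"
      by (intro exI[of _ "length ys"]) (simp add: p)
  qed
  from ptime_snd[OF ptime_snd[OF this]]
  have "ptime (\<lambda>p. fold (h (fst p)) (fst (snd p)) (snd (snd p)))" by simp
  then show ?thesis by (rule ptime_comp3[OF _ ptime_id assms(2,3)])
qed

text \<open>A step may add an amount that depends on \<open>x\<close> and the current element but
  not on the accumulator, so the total growth is at most the length of the list times that amount. A
  constant factor per step would already allow exponential growth.\<close>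

lemma ptime_fold:
  assumes step: "ptime (\<lambda>p. h (fst p) (fst (snd p)) (snd (snd p)))"
    and "ptime l" "ptime s"
    and B: "\<And>x y s. esize (h x y s) \<le> esize s + poly B (esize x + esize y)"
  shows "ptime (\<lambda>x. fold (h x) (l x) (s x))"
proof (rule ptime_fold_bounded[OF assms(1-3), where B = "[:0, 1:] + [:0, 1:] * B"])
  fix x ys s
  have "esize (fold (h x) ys s) \<le> esize s + length ys * poly B N"
    if "esize x + esize ys \<le> N" for N
    using that
  proof (induction ys arbitrary: s)
    case (Cons y ys)
    then have "esize (fold (h x) ys (h x y s)) \<le> esize (h x y s) + length ys * poly B N" by simp
    also have "esize (h x y s) \<le> esize s + poly B N"
      using B[of x y s] poly_nat_mono[of "esize x + esize y" N B] Cons.prems by simp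
    finally show ?case by simp
  qed simp
  then have "esize (fold (h x) ys s)
      \<le> esize s + length ys * poly B (esize x + esize ys + esize s)" by simp
  also have "length ys * poly B (esize x + esize ys + esize s)
      \<le> (esize x + esize ys + esize s) * poly B (esize x + esize ys + esize s)"
    using length_less_esize[of ys] by (intro mult_right_mono) auto
  finally show "esize (fold (h x) ys s) \<le> poly ([:0, 1:] + [:0, 1:] * B) (esize x + esize ys + esize s)"
    by simp
qed

lemma ptime_rev [ptime_intros]:
  assumes "ptime l"
  shows "ptime (\<lambda>x. rev (l x))"
proof -
  have "ptime (\<lambda>x. fold (\<lambda>y s. y # s) (l x) [])"
    by (rule ptime_fold[where B = "[:1, 1:]"]) (auto intro!: ptime_intros assms)
  then show ?thesis by (simp add: rev_conv_fold)
qed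

lemma ptime_append [ptime_intros]:
  assumes "ptime l" "ptime m"
  shows "ptime (\<lambda>x. l x @ m x)"
proof -
  have "ptime (\<lambda>x. fold (\<lambda>y s. y # s) (rev (l x)) (m x))"
    by (rule ptime_fold[where B = "[:1, 1:]"]) (auto intro!: ptime_intros assms)
  then show ?thesis by (simp add: fold_Cons_rev)
qed

lemma ptime_map [ptime_intros]:
  assumes "ptime l" "ptime (\<lambda>p. h (fst p) (snd p))"
  shows "ptime (\<lambda>x. map (h x) (l x))"
proof -
  obtain P where P: "\<And>p. esize (h (fst p) (snd p)) \<le> poly P (esize p)"
    using ptimeE[OF assms(2)] by metis
  have "ptime (\<lambda>x. fold (\<lambda>y s. h x y # s) (rev (l x)) [])"
  proof (rule ptime_fold[where B = "1 + pcompose P [:1, 1:]"])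
    show "esize (h x y # s) \<le> esize s + poly (1 + pcompose P [:1, 1:]) (esize x + esize y)" for x y s
      using P[of "(x, y)"] by (simp add: poly_pcompose)
  qed (intro ptime_intros assms ptime_comp2[OF assms(2)])+
  moreover have "fold (\<lambda>y s. h x y # s) (rev ys) [] = map (h x) ys" for x ys
    by (induction ys) auto
  ultimately show ?thesis by simp
qed

lemma ptime_filter [ptime_intros]:
  assumes "ptime l" "ptime (\<lambda>p. h (fst p) (snd p))"
  shows "ptime (\<lambda>x. filter (h x) (l x))"
proof -
  have "ptime (\<lambda>x. fold (\<lambda>y s. if h x y then y # s else s) (rev (l x)) [])"
    by (rule ptime_fold[where B = "[:1, 1:]"])
      (auto intro!: ptime_intros assms ptime_comp2[OF assms(2)])
  moreover have "fold (\<lambda>y s. if h x y then y # s else s) (rev ys) [] = filter (h x) ys" for x ys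
    by (induction ys) auto
  ultimately show ?thesis by simp
qed

lemma ptime_concat [ptime_intros]:
  assumes "ptime l"
  shows "ptime (\<lambda>x. concat (l x))"
proof -
  have "esize (y @ s) \<le> esize s + poly [:0, 1:] (esize x + esize y)" for x :: 'a and y s :: "'b list"
    using esize_append[of y s] by simp
  then have "ptime (\<lambda>x. fold (\<lambda>y s. y @ s) (rev (l x)) [])"
    by (intro ptime_fold[where B = "[:0, 1:]"]) (auto intro!: ptime_intros assms)
  moreover have "fold (\<lambda>y s. y @ s) (rev ys) [] = concat ys" for ys :: "'b list list"
    by (induction ys) auto
  ultimately show ?thesis by simp
qed

lemma ptime_list_all [ptime_intros]:
  assumes "ptime l" "ptime (\<lambda>p. h (fst p) (snd p))"
  shows "ptime (\<lambda>x. list_all (h x) (l x))"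
proof -
  have "ptime (\<lambda>x. case filter (\<lambda>y. \<not> h x y) (l x) of [] \<Rightarrow> True | y # ys \<Rightarrow> False)"
    by (intro ptime_intros assms)
  moreover have "(case filter (\<lambda>y. \<not> h x y) ys of [] \<Rightarrow> True | y # ys \<Rightarrow> False) = list_all (h x) ys" for x ys
    by (induction ys) auto
  ultimately show ?thesis by simp
qed

lemma ptime_length [ptime_intros]:
  assumes "ptime l"
  shows "ptime (\<lambda>x. int (length (l x)))"
proof -
  have "esize (s + 1) \<le> esize s + 2" for s :: int
    using esize_add_int[of s 1] by (simp add: esize_int floorlog_def)
  then have "ptime (\<lambda>x. fold (\<lambda>y s. s + 1 :: int) (l x) 0)"
    by (intro ptime_fold[where B = "[:2:]"]) (auto intro!: ptime_intros assms)
  moreover have "fold (\<lambda>y s. s + 1) ys k = int (length ys) + k" for ys :: "'b list" and k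
    by (induction ys arbitrary: k) auto
  ultimately show ?thesis by simp
qed

text \<open>A map that also sees \<open>p\<close>, increased by the increments of all earlier
  elements. It serves both to number the tasks and to follow the position along a tour.\<close>

primrec acc_map :: "('a \<Rightarrow> int) \<Rightarrow> (int \<Rightarrow> 'a \<Rightarrow> 'b) \<Rightarrow> int \<Rightarrow> 'a list \<Rightarrow> 'b list" where
  "acc_map d g p [] = []"
| "acc_map d g p (y # ys) = g p y # acc_map d g (p + d y) ys"

text \<open>\<open>ptime_fold\<close> does not apply, because the size of a new output depends on
  the position, which is part of the accumulator. Positions grow additively, though, so one
  \<open>M\<close> bounds them all, and \<open>M\<close> yields a bound \<open>G\<close> for all
  outputs.\<close>

lemma ptime_acc_map:
  fixes l :: "'a::encodable \<Rightarrow> 'b::encodable list" and g :: "'a \<Rightarrow> int \<Rightarrow> 'b \<Rightarrow> 'c::encodable"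
  assumes "ptime l" "ptime p" and d: "ptime (\<lambda>z. d (fst z) (snd z))"
    and g: "ptime (\<lambda>z. g (fst z) (fst (snd z)) (snd (snd z)))"
  shows "ptime (\<lambda>x. acc_map (d x) (g x) (p x) (l x))"
proof -
  obtain A where A: "\<And>z. esize (d (fst z) (snd z)) \<le> poly A (esize z)"
    using ptimeE[OF d] by metis
  obtain C where C: "\<And>z. esize (g (fst z) (fst (snd z)) (snd (snd z))) \<le> poly C (esize z)"
    using ptimeE[OF g] by metis
  define h where "h x y s = (fst s + d x y, g x (fst s) y # snd s)" for x y and s :: "int \<times> 'c list"
  have fold_h: "snd (fold (h x) ys (r, zs)) = rev (acc_map (d x) (g x) r ys) @ zs" for x ys r zs
    by (induction ys arbitrary: r zs) (auto simp: h_def)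
  have bound: "esize (fold (h x) ys (r, zs)) \<le> 1 + M + esize zs + length ys * (1 + G)"
    if "esize r + length ys * K \<le> M" "\<And>y. y \<in> set ys \<Longrightarrow> esize (d x y) \<le> K"
      "\<And>y r. y \<in> set ys \<Longrightarrow> esize r \<le> M \<Longrightarrow> esize (g x r y) \<le> G" for x ys r zs K M G
    using that
  proof (induction ys arbitrary: r zs)
    case (Cons y ys)
    have "esize (r + d x y) \<le> esize r + K"
      using esize_add_int[of r "d x y"] Cons.prems(2)[of y] by simp
    then have "esize (fold (h x) ys (r + d x y, g x r y # zs))
        \<le> 1 + M + esize (g x r y # zs) + length ys * (1 + G)"
      using Cons.prems by (intro Cons.IH) auto
    moreover have "esize (g x r y) \<le> G" using Cons.prems by auto
    moreover have "h x y (r, zs) = (r + d x y, g x r y # zs)" by (simp add: h_def)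
    ultimately show ?case by simp
  qed simp
  \<comment> \<open>This is \<open>1 + M + N + N * (1 + G)\<close> with the \<open>K\<close>,
    \<open>M\<close> and \<open>G\<close> introduced below written as polynomials in
    \<open>N\<close>.\<close>
  define B where "B = 1 + (([:0, 1:] + [:0, 1:] * pcompose A [:1, 1:]) + ([:0, 1:] + [:0, 1:] *
    (1 + pcompose C (2 + [:0, 1:] + ([:0, 1:] + [:0, 1:] * pcompose A [:1, 1:])))))"
  have "esize (fold (h x) ys s) \<le> poly B (esize x + esize ys + esize s)" for x ys s
  proof -
    obtain r zs where s: "s = (r, zs)" by (cases s)
    define N where "N = esize x + esize ys + esize s"
    define K where "K = poly A (1 + N)"
    define M where "M = N + N * K"
    define G where "G = poly C (2 + N + M)"
    have len: "length ys \<le> N" using length_less_esize[of ys] by (simp add: N_def)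
    have elem: "esize y \<le> esize ys" if "y \<in> set ys" for y
      using that by (induction ys) auto
    have "esize (fold (h x) ys (r, zs)) \<le> 1 + M + esize zs + length ys * (1 + G)"
    proof (rule bound)
      have "length ys * K \<le> N * K" using len by simp
      moreover have "esize r \<le> N" by (simp add: N_def s)
      ultimately show "esize r + length ys * K \<le> M" unfolding M_def by linarith
      show "esize (d x y) \<le> K" if "y \<in> set ys" for y
        using A[of "(x, y)"] elem[OF that] poly_nat_mono[of "esize (x, y)" "1 + N" A]
        by (simp add: K_def N_def)
      show "esize (g x r y) \<le> G" if "y \<in> set ys" "esize r \<le> M" for y r
        using C[of "(x, r, y)"] elem[OF that(1)] that(2)
          poly_nat_mono[of "esize (x, r, y)" "2 + N + M" C]
        by (simp add: G_def N_def)
    qed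
    also have "\<dots> \<le> 1 + M + N + N * (1 + G)"
      using len by (intro add_mono mult_right_mono) (auto simp: N_def s)
    also have "\<dots> = poly B N"
      by (simp add: B_def M_def G_def K_def poly_pcompose algebra_simps)
    finally show ?thesis by (simp add: s N_def)
  qed
  then have "ptime (\<lambda>x. fold (h x) (l x) (p x, []))"
    by (rule ptime_fold_bounded[rotated 3])
      (auto simp: h_def intro!: ptime_intros assms ptime_comp2[OF d] ptime_comp3[OF g])
  from ptime_rev[OF ptime_snd[OF this]] show ?thesis by (simp add: fold_h)
qed

section \<open>The algorithm\<close>

type_synonym arc = "int \<times> int \<times> int"

abbreviation src :: "arc \<Rightarrow> int" where "src a \<equiv> fst (snd a)"
abbreviation dst :: "arc \<Rightarrow> int" where "dst a \<equiv> snd (snd a)"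

text \<open>Time is scaled by \<open>D\<close> so that all endpoints are integers; the integer \<open>x\<close> stands for the
  cell \<open>[x, x + 1)\<close> of the circle of circumference \<open>D\<close>.\<close>

definition covers :: "int \<Rightarrow> int \<Rightarrow> arc \<Rightarrow> bool" where
  "covers D x a \<longleftrightarrow> (x - src a) mod D < dst a - src a"

definition load :: "int \<Rightarrow> arc list \<Rightarrow> int \<Rightarrow> int" where
  "load D ts x = int (length (filter (covers D x) ts))"

text \<open>The union with \<open>[]\<close> removes duplicates, since \<open>List.union\<close>
  inserts element by element. A repeated point would produce its idle arcs twice.\<close>

definition points :: "int \<Rightarrow> arc list \<Rightarrow> int list" where
  "points D ts = List.union (concat (map (\<lambda>a. [src a mod D, dst a mod D]) ts)) []"

text \<open>The shift by one gives distances in \<open>1..D\<close> instead of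
  \<open>0..D - 1\<close>: from a point to itself it is a full turn, so idle arcs exist even if
  there is a single point.\<close>

definition gap :: "int \<Rightarrow> int \<Rightarrow> int \<Rightarrow> int" where
  "gap D u v = (v - u - 1) mod D + 1"

text \<open>An idle arc (tag 0) leads from a point \<open>u\<close> to the next point. The tags of the tasks
  being \<open>1..n\<close>, the filter leaves \<open>min q (n + 1) - load u\<close> copies: with more than \<open>n + 1\<close> workers
  the surplus is left unused, so that the number of arcs is polynomial even though \<open>q\<close> is in binary.\<close>

definition idle_arcs :: "int \<Rightarrow> int \<Rightarrow> arc list \<Rightarrow> int list \<Rightarrow> arc list" where
  "idle_arcs D q ts P = concat (map (\<lambda>u. concat (map (\<lambda>v.
     map (\<lambda>j. (0, u, u + gap D u v)) (filter (\<lambda>j. load D ts u \<le> j \<and> j < q) (0 # map fst ts)))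
     (filter (\<lambda>v. list_all (\<lambda>w. gap D u v \<le> gap D u w) P) P))) P)"

definition all_arcs :: "int \<Rightarrow> int \<Rightarrow> arc list \<Rightarrow> arc list" where
  "all_arcs D q ts = ts @ idle_arcs D q ts (points D ts)"

text \<open>A state consists of the walk built so far, in reverse order, and of the unused arcs. In an
  Eulerian graph a walk that cannot be extended is closed, so rotating it gives again a walk.\<close>

definition tour_step :: "int \<Rightarrow> arc list \<times> arc list \<Rightarrow> arc list \<times> arc list" where
  "tour_step D s = (case fst s of [] \<Rightarrow> s | t # T \<Rightarrow>
     (case filter (\<lambda>a. (src a - dst t) mod D = 0) (snd s) of
       [] \<Rightarrow> (T @ [t], snd s)
     | a # as \<Rightarrow> (a # fst s, as @ filter (\<lambda>a. (src a - dst t) mod D \<noteq> 0) (snd s))))"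

text \<open>Both folds use \<open>as\<close> as a counter. A round of \<open>length as\<close> steps
  either extends the walk or rotates it far enough to inspect every vertex on it, and fewer than
  \<open>length as\<close> rounds can extend it.\<close>

definition tour :: "int \<Rightarrow> arc list \<Rightarrow> arc list \<times> arc list" where
  "tour D as = (case as of [] \<Rightarrow> ([], []) | a # R \<Rightarrow>
     fold (\<lambda>_. fold (\<lambda>_. tour_step D) as) as ([a], R))"

text \<open>\<open>p\<close> is the time reached when the tour is unrolled onto the line. On a walk
  it agrees with \<open>src a\<close> modulo \<open>D\<close>, and the quotient is the number of
  whole turns by which this task is shifted. Idle arcs get entries as well, under tag 0.\<close>

definition offsets :: "int \<Rightarrow> arc list \<Rightarrow> (int \<times> int) list" where
  "offsets D T = acc_map (\<lambda>a. dst a - src a) (\<lambda>p a. (fst a, (p - src a) div D))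
     (case T of [] \<Rightarrow> 0 | a # _ \<Rightarrow> src a) T"

type_synonym raw_task = "(int \<times> int) \<times> (int \<times> int)"

text \<open>The plain product of all denominators is good enough as a common denominator: its bit
  size grows at most additively with each factor.\<close>

definition denom :: "raw_task list \<Rightarrow> int" where
  "denom rs = fold (\<lambda>r p. p * (snd (fst r) * snd (snd r))) rs 1"

definition scaled_tasks :: "raw_task list \<Rightarrow> arc list" where
  "scaled_tasks rs = acc_map (\<lambda>_. 1) (\<lambda>i r. (i, fst (fst r) * (denom rs div snd (fst r)),
     fst (snd r) * (denom rs div snd (snd r)))) 1 rs"

text \<open>The load is constant between points, so testing it at the points settles it everywhere.
  The empty rest of the tour is the test of connectedness.\<close>

definition decide_fun :: "int \<times> int \<times> raw_task list \<Rightarrow> bool" where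
  "decide_fun z = (let q = fst (snd z); rs = snd (snd z); D = denom rs; ts = scaled_tasks rs in
     list_all (\<lambda>u. load D ts u \<le> q) (points D ts) \<and>
     (case snd (tour D (all_arcs D q ts)) of [] \<Rightarrow> True | _ # _ \<Rightarrow> False))"

definition construct_fun :: "int \<times> int \<times> raw_task list \<Rightarrow> int \<times> (int \<times> int) list" where
  "construct_fun z = (let q = fst (snd z); rs = snd (snd z); D = denom rs; ts = scaled_tasks rs in
     (q, offsets D (rev (fst (tour D (all_arcs D q ts))))))"

text \<open>The fold keeps the last entry for \<open>i\<close>, with default 0; the tag of a task
  has just one entry in the lists of interest.\<close>

definition assoc_val :: "(int \<times> int) list \<Rightarrow> int \<Rightarrow> int" where
  "assoc_val ks i = fold (\<lambda>y s. if fst y = i then snd y else s) ks 0"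

text \<open>The description consists of \<open>q\<close> in binary and one offset per arc. Reducing
  modulo \<open>q\<close> only at lookup keeps it small although the period is
  \<open>q\<close>.\<close>

definition lookup_fun :: "(int \<times> (int \<times> int) list) \<times> int \<times> int \<Rightarrow> int" where
  "lookup_fun z = 1 + (snd (snd z) - assoc_val (snd (fst z)) (fst (snd z))) mod fst (fst z)"

section \<open>Polynomial running time of the algorithm\<close>

lemma ptime_covers: "ptime (\<lambda>z. covers (fst z) (fst (snd z)) (snd (snd z)))"
  unfolding covers_def by (intro ptime_intros)

lemma ptime_load: "ptime (\<lambda>z. load (fst z) (fst (snd z)) (snd (snd z)))"
  unfolding load_def by (intro ptime_intros ptime_comp3[OF ptime_covers])

lemma ptime_union_int:
  assumes "ptime f" "ptime g"
  shows "ptime (\<lambda>x. List.union (f x) (g x :: int list))"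
proof -
  have "ptime (\<lambda>x. fold (\<lambda>y s. if list_all (\<lambda>w. w \<noteq> y) s then y # s else s) (f x) (g x))"
    by (rule ptime_fold[where B = "[:1, 1:]"]) (auto intro!: ptime_intros assms)
  moreover have "(\<lambda>y (s :: int list). if list_all (\<lambda>w. w \<noteq> y) s then y # s else s) = List.insert"
    by (auto simp: fun_eq_iff List.insert_def list_all_iff)
  ultimately show ?thesis by (simp only: List.union_def)
qed

lemma ptime_points: "ptime (\<lambda>z. points (fst z) (snd z))"
  unfolding points_def by (intro ptime_intros ptime_union_int)

lemma ptime_gap: "ptime (\<lambda>z. gap (fst z) (fst (snd z)) (snd (snd z)))"
  unfolding gap_def by (intro ptime_intros)

lemma ptime_idle_arcs:
  "ptime (\<lambda>z. idle_arcs (fst z) (fst (snd z)) (fst (snd (snd z))) (snd (snd (snd z))))"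
  unfolding idle_arcs_def by (intro ptime_intros ptime_comp3[OF ptime_gap] ptime_comp3[OF ptime_load])

lemma ptime_all_arcs: "ptime (\<lambda>z. all_arcs (fst z) (fst (snd z)) (snd (snd z)))"
proof -
  have "ptime (\<lambda>z. (fst z, fst (snd z), snd (snd z), points (fst z) (snd (snd z))))"
    by (intro ptime_intros ptime_comp2[OF ptime_points])
  from ptime_comp[OF ptime_idle_arcs this] show ?thesis
    unfolding all_arcs_def by (intro ptime_intros) simp_all
qed

text \<open>Arcs only move between or within the two lists, which preserves the total size. Both
  folds of \<open>tour\<close> thus run on states of constant size, and \<open>ptime_fold\<close>
  applies with increment 0.\<close>

lemma esize_tour_step: "esize (tour_step D s) = esize s"
proof -
  have part: "esize (filter P xs) + esize (filter (\<lambda>x. \<not> P x) xs) = esize xs + 1"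
    for P :: "arc \<Rightarrow> bool" and xs by (induction xs) auto
  show ?thesis
  proof (cases "fst s")
    case (Cons t T)
    show ?thesis
    proof (cases "filter (\<lambda>a. (src a - dst t) mod D = 0) (snd s)")
      case Nil
      then show ?thesis using Cons esize_append[of T "[t]"]
        by (cases s) (auto simp: tour_step_def)
    next
      case (Cons a as)
      then show ?thesis using \<open>fst s = t # T\<close> part[of "\<lambda>a. (src a - dst t) mod D = 0" "snd s"]
          esize_append[of as "filter (\<lambda>a. (src a - dst t) mod D \<noteq> 0) (snd s)"]
        by (cases s) (simp add: tour_step_def)
    qed
  qed (simp add: tour_step_def)
qed

lemma ptime_tour_step: "ptime (\<lambda>z. tour_step (fst z) (snd z))"
  unfolding tour_step_def by (intro ptime_intros)

lemma esize_fold_tour_step: "esize (fold (\<lambda>_. tour_step D) ys s) = esize s"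
  by (induction ys arbitrary: s) (auto simp: esize_tour_step)

lemma ptime_tour: "ptime (\<lambda>z. tour (fst z) (snd z))"
proof -
  have 1: "ptime (\<lambda>z. fold (\<lambda>_. tour_step (fst z)) (fst (snd z)) (snd (snd z)))"
    by (rule ptime_fold[where B = 0])
      (auto intro!: ptime_intros ptime_comp2[OF ptime_tour_step] simp: esize_tour_step)
  have 2: "ptime (\<lambda>z. fold (\<lambda>_. fold (\<lambda>_. tour_step (fst z)) (fst (snd z))) (fst (snd z)) (snd (snd z)))"
    by (rule ptime_fold[where B = 0])
      (auto intro!: ptime_intros ptime_comp3[OF 1] simp: esize_fold_tour_step)
  show ?thesis unfolding tour_def by (intro ptime_intros ptime_comp3[OF 2])
qed

lemma ptime_offsets: "ptime (\<lambda>z. offsets (fst z) (snd z))"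
  unfolding offsets_def by (intro ptime_intros ptime_acc_map)

lemma ptime_denom: "ptime denom"
proof -
  have "esize (p * (snd (fst r) * snd (snd r))) \<le> esize p + poly [:0, 1:] (esize x + esize r)"
    for x :: "raw_task list" and p and r :: raw_task
    using esize_mult_int[of p "snd (fst r) * snd (snd r)"]
      esize_mult_int[of "snd (fst r)" "snd (snd r)"] by (simp add: esize_prod)
  then show ?thesis unfolding denom_def
    by (intro ptime_fold[where B = "[:0, 1:]"]) (auto intro!: ptime_intros)
qed

lemma ptime_scaled_tasks: "ptime scaled_tasks"
  unfolding scaled_tasks_def by (intro ptime_intros ptime_acc_map ptime_comp[OF ptime_denom])

lemma ptime_decide_fun: "ptime decide_fun"
  unfolding decide_fun_def Let_def
  by (intro ptime_intros ptime_comp3[OF ptime_load] ptime_comp2[OF ptime_points]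
      ptime_comp2[OF ptime_tour] ptime_comp3[OF ptime_all_arcs] ptime_comp[OF ptime_denom]
      ptime_comp[OF ptime_scaled_tasks])

lemma ptime_construct_fun: "ptime construct_fun"
  unfolding construct_fun_def Let_def
  by (intro ptime_intros ptime_comp2[OF ptime_offsets]
      ptime_comp2[OF ptime_tour] ptime_comp3[OF ptime_all_arcs] ptime_comp[OF ptime_denom]
      ptime_comp[OF ptime_scaled_tasks])

lemma ptime_assoc_val: "ptime (\<lambda>z. assoc_val (fst z) (snd z))"
  unfolding assoc_val_def
  by (rule ptime_fold[where B = "[:0, 1:]"]) (auto intro!: ptime_intros simp: esize_prod)

lemma ptime_lookup_fun: "ptime lookup_fun"
  unfolding lookup_fun_def by (intro ptime_intros ptime_comp2[OF ptime_assoc_val])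

section \<open>Covering numbers and idle arcs\<close>

text \<open>A discrete derivative: covering changes only at the two ends. An arc of length
  \<open>D\<close> covers every cell, and its ends coincide modulo \<open>D\<close>, so that the
  terms on the right cancel; this is the case \<open>y = 0 \<and> l = D\<close>.\<close>

lemma covers_step:
  assumes "src a < dst a" "dst a - src a \<le> D"
  shows "(of_bool (covers D x a) :: int) - of_bool (covers D (x - 1) a)
    = of_bool (D dvd x - src a) - of_bool (D dvd x - dst a)"
proof -
  define y where "y = (x - src a) mod D"
  define l where "l = dst a - src a"
  have D: "D > 0" and l: "0 < l" "l \<le> D" using assms by (auto simp: l_def)
  have y: "0 \<le> y" "y < D" using D by (auto simp: y_def)
  have "(x - 1 - src a) mod D = (y - 1) mod D"
    unfolding y_def by (simp add: mod_diff_left_eq algebra_simps)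
  also have "\<dots> = (if y = 0 then D - 1 else y - 1)"
    using y D by (auto simp: zmod_minus1)
  finally have 1: "(x - 1 - src a) mod D = (if y = 0 then D - 1 else y - 1)" .
  have 2: "D dvd x - src a \<longleftrightarrow> y = 0" by (simp add: y_def dvd_eq_mod_eq_0)
  have "D dvd x - dst a \<longleftrightarrow> (y - l) mod D = 0"
    using mod_diff_left_eq[of "x - src a" D l] by (simp add: dvd_eq_mod_eq_0 y_def l_def)
  also have "\<dots> \<longleftrightarrow> y = l \<or> y = 0 \<and> l = D"
  proof (cases "y \<ge> l")
    case True
    then show ?thesis using y l by auto
  next
    case False
    have "(y - l) mod D = (y - l + D) mod D" by simp
    also have "\<dots> = (if y = 0 \<and> l = D then 0 else y - l + D)"
      using False y l by (auto simp del: mod_add_self2)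
    finally show ?thesis using False y l by auto
  qed
  finally have 3: "D dvd x - dst a \<longleftrightarrow> y = l \<or> y = 0 \<and> l = D" .
  show ?thesis unfolding covers_def 1 2 3 using y l
    by (auto simp: y_def[symmetric] l_def[symmetric])
qed

lemma covers_cong: "(D::int) dvd x - y \<Longrightarrow> covers D x a = covers D y a"
  unfolding covers_def by (metis mod_diff_cong mod_eq_dvd_iff)

lemma load_cong: "(D::int) dvd x - y \<Longrightarrow> load D as x = load D as y"
  unfolding load_def using covers_cong[of D x y] by (simp cong: filter_cong)

lemma load_append: "load D (as @ bs) x = load D as x + load D bs x"
  by (simp add: load_def)

lemma load_Cons: "load D (a # as) x = of_bool (covers D x a) + load D as x"
  by (simp add: load_def)

definition starts :: "int \<Rightarrow> arc list \<Rightarrow> int \<Rightarrow> int" where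
  "starts D as x = int (length (filter (\<lambda>a. D dvd x - src a) as))"

definition ends :: "int \<Rightarrow> arc list \<Rightarrow> int \<Rightarrow> int" where
  "ends D as x = int (length (filter (\<lambda>a. D dvd x - dst a) as))"

text \<open>\<open>starts\<close> counts the arcs that leave the vertex \<open>x\<close> and
  \<open>ends\<close> those that enter it, so a constant load amounts to equal degrees at every
  vertex.\<close>

lemma load_step:
  assumes "\<And>a. a \<in> set as \<Longrightarrow> src a < dst a" "\<And>a. a \<in> set as \<Longrightarrow> dst a - src a \<le> D"
  shows "load D as x - load D as (x - 1) = starts D as x - ends D as x"
  using assms
proof (induction as)
  case (Cons a as)
  then have "load D as x - load D as (x - 1) = starts D as x - ends D as x" by simp
  moreover have "starts D (a # as) x = of_bool (D dvd x - src a) + starts D as x"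
    "ends D (a # as) x = of_bool (D dvd x - dst a) + ends D as x"
    by (auto simp: starts_def ends_def)
  ultimately show ?case using covers_step[of a D x] Cons.prems by (simp add: load_Cons)
qed (simp add: load_def starts_def ends_def)

text \<open>The covered cells are the residues of the integers from \<open>src a\<close> to
  \<open>dst a - 1\<close>, which are distinct because the length is at most
  \<open>D\<close>.\<close>

lemma sum_covers:
  assumes "src a < dst a" "dst a - src a \<le> D"
  shows "(\<Sum>x\<in>{0..<D}. of_bool (covers D x a) :: int) = dst a - src a"
proof -
  have D: "D > 0" using assms by linarith
  have "bij_betw (\<lambda>x. (x - src a) mod D) {x \<in> {0..<D}. covers D x a} {0..<dst a - src a}"
  proof (rule bij_betw_byWitness[where f' = "\<lambda>y. (y + src a) mod D"])
    show "\<forall>x\<in>{x \<in> {0..<D}. covers D x a}. ((x - src a) mod D + src a) mod D = x"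
      by (simp add: mod_add_left_eq)
    show "\<forall>y\<in>{0..<dst a - src a}. ((y + src a) mod D - src a) mod D = y"
      using assms by (simp add: mod_diff_left_eq)
    show "(\<lambda>x. (x - src a) mod D) ` {x \<in> {0..<D}. covers D x a} \<subseteq> {0..<dst a - src a}"
      using D by (auto simp: covers_def)
    show "(\<lambda>y. (y + src a) mod D) ` {0..<dst a - src a} \<subseteq> {x \<in> {0..<D}. covers D x a}"
      using D assms by (auto simp: covers_def mod_diff_left_eq)
  qed
  then have "card {x \<in> {0..<D}. covers D x a} = nat (dst a - src a)"
    by (simp add: bij_betw_same_card)
  moreover have "(\<Sum>x\<in>{0..<D}. of_bool (covers D x a) :: int) = int (card {x \<in> {0..<D}. covers D x a})"
    by (simp add: Int_def)
  ultimately show ?thesis using assms by simp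
qed

lemma sum_load:
  assumes "\<And>a. a \<in> set as \<Longrightarrow> src a < dst a" "\<And>a. a \<in> set as \<Longrightarrow> dst a - src a \<le> D"
  shows "(\<Sum>x\<in>{0..<D}. load D as x) = (\<Sum>a\<leftarrow>as. dst a - src a)"
  using assms
proof (induction as)
  case (Cons a as)
  then show ?case using sum_covers[of a D] by (simp add: load_Cons sum.distrib)
qed (simp add: load_def)

section \<open>Consecutive points on the circle and the idle arcs between them\<close>

lemma filter_eq_singleton: "v \<in> set xs \<Longrightarrow> distinct xs \<Longrightarrow> filter (\<lambda>w. w = v) xs = [v]"
  by (induction xs) (auto simp: filter_empty_conv)

text \<open>The bounds on \<open>dst a\<close> make occurrence \<open>r\<close> end after
  \<open>r * D\<close> and no later than \<open>(r + 1) * D\<close>, which ties occurrence numbers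
  to time. The tags turn \<open>0 # map fst ts\<close> into the list of \<open>0..n\<close> from
  which idle copies are counted.\<close>

locale int_tasks =
  fixes D q :: int and ts :: "arc list"
  assumes D_pos: "D > 0" and q_pos: "q > 0" and ts_nonempty: "ts \<noteq> []"
    and tags: "map fst ts = [1..int (length ts)]"
    and task_bounds: "\<And>a. a \<in> set ts \<Longrightarrow> src a < dst a \<and> dst a - src a \<le> D \<and> 0 < dst a \<and> dst a \<le> D"
begin

abbreviation P :: "int list" where "P \<equiv> points D ts"

definition len :: "int \<Rightarrow> int" where
  "len u = Min (gap D u ` set P)"

definition capacity :: int where
  "capacity = min q (int (length ts) + 1)"

lemma set_points: "set P = (\<lambda>a. src a mod D) ` set ts \<union> (\<lambda>a. dst a mod D) ` set ts"
  unfolding points_def by auto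

lemma distinct_points: "distinct P"
  unfolding points_def by simp

lemma points_bounds: "u \<in> set P \<Longrightarrow> 0 \<le> u \<and> u < D"
  using D_pos by (auto simp: set_points)

lemma points_nonempty: "set P \<noteq> {}"
  using ts_nonempty by (auto simp: set_points)

lemma load_nonpoint:
  assumes "x mod D \<notin> set P"
  shows "load D ts x = load D ts (x - 1)"
proof -
  have "filter (\<lambda>a. D dvd x - src a) ts = []" "filter (\<lambda>a. D dvd x - dst a) ts = []"
    using assms by (auto simp: filter_empty_conv set_points mod_eq_dvd_iff[symmetric])
  then have "starts D ts x = 0" "ends D ts x = 0" by (simp_all add: starts_def ends_def)
  then show ?thesis using load_step[of ts D x] task_bounds by fastforce
qed

lemma gap_bounds: "1 \<le> gap D u v" "gap D u v \<le> D"
  using pos_mod_bound[OF D_pos, of "v - u - 1"] pos_mod_sign[OF D_pos, of "v - u - 1"]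
  by (simp_all add: gap_def)

lemma gap_add: "(u + gap D u v) mod D = v mod D"
proof -
  have "(u + gap D u v) mod D = (u + 1 + (v - u - 1) mod D) mod D"
    by (simp add: gap_def algebra_simps)
  also have "\<dots> = v mod D" by (simp add: mod_add_right_eq)
  finally show ?thesis .
qed

lemma gap_inj:
  assumes "v \<in> set P" "w \<in> set P" "gap D u v = gap D u w"
  shows "v = w"
proof -
  have "v mod D = w mod D" by (metis assms(3) gap_add)
  then show ?thesis using points_bounds[OF assms(1)] points_bounds[OF assms(2)] by simp
qed

lemma len_witness: "\<exists>v\<in>set P. len u = gap D u v"
proof -
  have "len u \<in> gap D u ` set P"
    unfolding len_def using points_nonempty by (intro Min_in) auto
  then show ?thesis by auto
qed

lemma len_le: "w \<in> set P \<Longrightarrow> len u \<le> gap D u w"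
  unfolding len_def by simp

lemma len_bounds: "1 \<le> len u" "len u \<le> D"
  using len_witness[of u] gap_bounds by auto

lemma len_add: "(u + len u) mod D \<in> set P"
proof -
  obtain v where "v \<in> set P" "len u = gap D u v" using len_witness by blast
  then show ?thesis using gap_add[of u v] points_bounds[of v] by simp
qed

text \<open>Suppose \<open>x\<close> lies in the gaps after \<open>u\<close> and after
  \<open>u'\<close>, with \<open>u\<close> at least as close behind \<open>x\<close>. Then, if they
  differ, \<open>u\<close> follows \<open>u'\<close> at a distance below \<open>len u'\<close>,
  although \<open>len u'\<close> is the distance from \<open>u'\<close> to the next point.\<close>

lemma covering_point_unique:
  assumes "u \<in> set P" "u' \<in> set P" "(x - u) mod D < len u" "(x - u') mod D < len u'"
  shows "u = u'"
proof -
  have *: "u = u'" if "u \<in> set P" "u' \<in> set P" "(x - u') mod D < len u'"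
    "(x - u) mod D \<le> (x - u') mod D" for u u'
  proof (rule ccontr)
    assume "u \<noteq> u'"
    let ?d = "(x - u') mod D - (x - u) mod D"
    have "0 \<le> (x - u) mod D" "(x - u') mod D < D" using D_pos by auto
    then have d: "0 \<le> ?d" "?d < D" using that(4) by linarith+
    have "?d mod D = ((x - u') - (x - u)) mod D" by (simp add: mod_diff_eq)
    then have du: "?d = (u - u') mod D" using d by simp
    have "?d \<noteq> 0"
    proof
      assume "?d = 0"
      then have "u mod D = u' mod D" using du by (simp add: mod_eq_dvd_iff dvd_eq_mod_eq_0)
      then show False using \<open>u \<noteq> u'\<close> that points_bounds by simp
    qed
    moreover have "(u - u' - 1) mod D = (?d - 1) mod D" by (simp add: du mod_diff_left_eq)
    ultimately have "gap D u' u = ?d" using d by (simp add: gap_def)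
    then show False using len_le[OF that(1), of u'] that(3) \<open>0 \<le> (x - u) mod D\<close> by linarith
  qed
  show ?thesis using *[of u u'] *[of u' u] assms by linarith
qed

text \<open>The point closest behind \<open>x\<close> has this property: were \<open>x\<close> at
  distance \<open>len u\<close> or more from it, the next point would be closer still.\<close>

lemma covering_point_exists: "\<exists>u\<in>set P. (x - u) mod D < len u"
proof -
  define m where "m = Min ((\<lambda>u. (x - u) mod D) ` set P)"
  have "m \<in> (\<lambda>u. (x - u) mod D) ` set P"
    unfolding m_def using points_nonempty by (intro Min_in) auto
  then obtain u where u: "u \<in> set P" "m = (x - u) mod D" by auto
  have m: "m \<le> (x - w) mod D" if "w \<in> set P" for w
    unfolding m_def using that by simp
  obtain v where v: "v \<in> set P" "len u = gap D u v" using len_witness by blast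
  have "m < len u"
  proof (rule ccontr)
    assume "\<not> m < len u"
    moreover have "m < D" using u(2) D_pos by simp
    ultimately have "0 \<le> m - len u" "m - len u < D" using len_bounds[of u] by linarith+
    moreover have "(x - v) mod D = (m - len u) mod D"
    proof -
      have "(m - len u) mod D = (x - (u + len u)) mod D"
        by (simp add: u(2) mod_diff_left_eq algebra_simps)
      also have "\<dots> = (x - v) mod D"
        using gap_add[of u v] v(2) mod_diff_cong[of x D x "u + gap D u v" v] by simp
      finally show ?thesis by simp
    qed
    ultimately have "(x - v) mod D = m - len u" by simp
    then show False using m[OF v(1)] len_bounds[of u] by linarith
  qed
  with u show ?thesis by auto
qed

definition last_point :: "int \<Rightarrow> int" where
  "last_point x = (THE u. u \<in> set P \<and> (x - u) mod D < len u)"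

lemma last_point: "last_point x \<in> set P" "(x - last_point x) mod D < len (last_point x)"
proof -
  have "\<exists>!u. u \<in> set P \<and> (x - u) mod D < len u"
    using covering_point_exists covering_point_unique by blast
  from theI'[OF this] show "last_point x \<in> set P" "(x - last_point x) mod D < len (last_point x)"
    unfolding last_point_def by auto
qed

lemma last_point_eqI: "u \<in> set P \<Longrightarrow> (x - u) mod D < len u \<Longrightarrow> last_point x = u"
  using covering_point_unique last_point by blast

lemma last_point_of_point: "x mod D \<in> set P \<Longrightarrow> last_point x = x mod D"
  using len_bounds[of "x mod D"] by (intro last_point_eqI) (simp_all add: mod_diff_right_eq)

lemma load_within_gap: "int j < len u \<Longrightarrow> load D ts (u + int j) = load D ts u"
proof (induction j)
  case (Suc j)
  have "(u + int (Suc j)) mod D \<notin> set P"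
  proof
    assume "(u + int (Suc j)) mod D \<in> set P"
    then have "len u \<le> gap D u ((u + int (Suc j)) mod D)" by (rule len_le)
    also have "\<dots> = ((u + int (Suc j)) - (u + 1)) mod D + 1"
      by (simp add: gap_def mod_diff_left_eq diff_diff_eq)
    also have "\<dots> = int j + 1" using Suc.prems len_bounds[of u] by simp
    finally show False using Suc.prems by simp
  qed
  from load_nonpoint[OF this] Suc show ?case by (simp add: algebra_simps)
qed simp

lemma load_last_point: "load D ts (last_point x) = load D ts x"
proof -
  define u j where "u = last_point x" and "j = nat ((x - u) mod D)"
  have j: "int j = (x - u) mod D" using D_pos by (simp add: j_def)
  have "load D ts (u + int j) = load D ts u"
    using last_point(2)[of x] by (intro load_within_gap) (simp add: j u_def)
  moreover have "load D ts (u + int j) = load D ts x"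
    by (rule load_cong) (simp add: j mod_eq_dvd_iff[symmetric] mod_add_right_eq)
  ultimately show ?thesis by (simp add: u_def)
qed

lemma load_nonneg: "0 \<le> load D as x"
  by (simp add: load_def)

lemma load_le_length: "load D ts x \<le> int (length ts)"
  by (simp add: load_def)

definition idle_count :: "int \<Rightarrow> nat" where
  "idle_count u = nat (capacity - load D ts u)"

text \<open>The filter on \<open>v\<close> leaves exactly the point after \<open>u\<close>, as
  different points have different distances from \<open>u\<close>. The filter on the tags leaves the
  integers from the load up to \<open>capacity - 1\<close>.\<close>

lemma idle_arcs_eq:
  "idle_arcs D q ts P = concat (map (\<lambda>u. replicate (idle_count u) (0, u, u + len u)) P)"
proof -
  have "concat (map (\<lambda>v. map (\<lambda>j. (0 :: int, u, u + gap D u v))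
        (filter (\<lambda>j. load D ts u \<le> j \<and> j < q) (0 # map fst ts)))
      (filter (\<lambda>v. list_all (\<lambda>w. gap D u v \<le> gap D u w) P) P))
    = replicate (idle_count u) (0, u, u + len u)" for u
  proof -
    obtain v where v: "v \<in> set P" "len u = gap D u v" using len_witness by blast
    have "list_all (\<lambda>w. gap D u v' \<le> gap D u w) P \<longleftrightarrow> v' = v" if "v' \<in> set P" for v'
    proof
      assume "list_all (\<lambda>w. gap D u v' \<le> gap D u w) P"
      then have "gap D u v' \<le> gap D u v" using v by (auto simp: list_all_iff)
      moreover have "gap D u v \<le> gap D u v'" using len_le[OF that, of u] v(2) by simp
      ultimately show "v' = v" using gap_inj[OF that v(1)] by simp
    qed (use v len_le[of _ u] in \<open>auto simp: list_all_iff\<close>)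
    then have "filter (\<lambda>v. list_all (\<lambda>w. gap D u v \<le> gap D u w) P) P = filter (\<lambda>w. w = v) P"
      by (intro filter_cong) auto
    also have "\<dots> = [v]"
      using v(1) distinct_points by (rule filter_eq_singleton)
    finally have 1: "filter (\<lambda>v. list_all (\<lambda>w. gap D u v \<le> gap D u w) P) P = [v]" .
    have "0 # map fst ts = [0..int (length ts)]"
      unfolding tags by (simp add: upto_rec1)
    then have "length (filter (\<lambda>j. load D ts u \<le> j \<and> j < q) (0 # map fst ts))
        = length (filter (\<lambda>j. load D ts u \<le> j \<and> j < q) [0..int (length ts)])" by (rule arg_cong)
    also have "\<dots> = card ({j \<in> {0..int (length ts)}. load D ts u \<le> j \<and> j < q})"
      by (subst distinct_card[symmetric]) (auto intro!: arg_cong[where f = card])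
    also have "{j \<in> {0..int (length ts)}. load D ts u \<le> j \<and> j < q} = {load D ts u..<capacity}"
      using load_nonneg[of ts u] by (auto simp: capacity_def)
    also have "card \<dots> = idle_count u" by (simp add: idle_count_def)
    finally have 2: "length (filter (\<lambda>j. load D ts u \<le> j \<and> j < q) (0 # map fst ts)) = idle_count u" .
    show ?thesis unfolding 1 using 2 v(2) by (simp add: map_replicate_const del: filter.simps)
  qed
  then show ?thesis unfolding idle_arcs_def by (simp only:)
qed

abbreviation arcs :: "arc list" where "arcs \<equiv> all_arcs D q ts"

lemma arcs_cases:
  assumes "a \<in> set arcs"
  obtains "a \<in> set ts" | u where "u \<in> set P" "a = (0, u, u + len u)"
  using assms by (auto simp: all_arcs_def idle_arcs_eq)

lemma arcs_len: "a \<in> set arcs \<Longrightarrow> src a < dst a \<and> dst a - src a \<le> D"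
proof (elim arcs_cases)
  fix u assume "a = (0, u, u + len u)"
  then show "src a < dst a \<and> dst a - src a \<le> D" using len_bounds[of u] by simp
qed (use task_bounds in blast)

lemma arcs_endpoints: "a \<in> set arcs \<Longrightarrow> src a mod D \<in> set P \<and> dst a mod D \<in> set P"
proof (elim arcs_cases)
  fix u assume "u \<in> set P" "a = (0, u, u + len u)"
  then show "src a mod D \<in> set P \<and> dst a mod D \<in> set P" using len_add[of u] points_bounds[of u] by simp
qed (auto simp: set_points)

text \<open>The cap at \<open>n + 1\<close> cuts no connection: the load is at most
  \<open>n\<close>, so at least one idle copy survives wherever a worker may be idle.\<close>

lemma idle_arc_in_arcs:
  assumes "u \<in> set P" "load D ts u < q"
  shows "(0, u, u + len u) \<in> set arcs"
proof -
  have "idle_count u \<noteq> 0" using assms load_le_length[of u] by (simp add: idle_count_def capacity_def)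
  then show ?thesis using assms by (auto simp: all_arcs_def idle_arcs_eq)
qed

text \<open>Each cell lies in the gap after exactly one point, its \<open>last_point\<close>. Hence
  a single bundle of idle arcs covers it, with as many copies as the load falls short of
  \<open>capacity\<close>.\<close>

lemma load_arcs:
  assumes "\<And>u. u \<in> set P \<Longrightarrow> load D ts u \<le> q"
  shows "load D arcs x = capacity"
proof -
  have rep: "load D (replicate m a) x = (if covers D x a then int m else 0)" for m a
    by (simp add: load_def filter_replicate)
  have "load D (concat (map f us)) x = (\<Sum>u\<leftarrow>us. load D (f u) x)" for f and us :: "int list"
    by (induction us) (auto simp: load_def)
  then have "load D (idle_arcs D q ts P) x
      = (\<Sum>u\<leftarrow>P. if (x - u) mod D < len u then int (idle_count u) else 0)"
    by (simp add: idle_arcs_eq rep covers_def)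
  also have "\<dots> = (\<Sum>u\<in>set P. if (x - u) mod D < len u then int (idle_count u) else 0)"
    using distinct_points by (simp add: sum_list_distinct_conv_sum_set)
  also have "\<dots> = (\<Sum>u\<in>set P. if u = last_point x then int (idle_count u) else 0)"
  proof (intro sum.cong refl if_cong)
    fix u assume "u \<in> set P"
    then show "(x - u) mod D < len u \<longleftrightarrow> u = last_point x"
      using last_point(2)[of x] last_point_eqI[of u x] by blast
  qed
  also have "\<dots> = int (idle_count (last_point x))" using last_point(1)[of x] by simp
  also have "\<dots> = capacity - load D ts x"
    using assms[OF last_point(1)[of x]] load_le_length[of x] load_last_point[of x]
    by (simp add: idle_count_def capacity_def)
  finally show ?thesis by (simp add: all_arcs_def load_append)
qed

lemma arcs_eulerian:
  assumes "\<And>u. u \<in> set P \<Longrightarrow> load D ts u \<le> q"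
  shows "starts D arcs x = ends D arcs x"
  using load_step[of arcs D x] load_arcs[OF assms] arcs_len by simp

lemma arcs_total_length:
  assumes "\<And>u. u \<in> set P \<Longrightarrow> load D ts u \<le> q"
  shows "(\<Sum>a\<leftarrow>arcs. dst a - src a) = D * capacity"
  using sum_load[of arcs D] load_arcs[OF assms] arcs_len D_pos by simp

end

section \<open>Eulerian tours\<close>

text \<open>The latest arc is at the head of the list, so \<open>b\<close> is the arc that follows
  \<open>a\<close> in time.\<close>

abbreviation walk :: "int \<Rightarrow> arc list \<Rightarrow> bool" where
  "walk D \<equiv> successively (\<lambda>b a. D dvd src b - dst a)"

lemma starts_mset: "starts D as x = int (size (filter_mset (\<lambda>a. D dvd x - src a) (mset as)))"
  by (simp add: starts_def flip: mset_filter)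

lemma ends_mset: "ends D as x = int (size (filter_mset (\<lambda>a. D dvd x - dst a) (mset as)))"
  by (simp add: ends_def flip: mset_filter)

text \<open>An intermediate visit to \<open>v\<close> pairs an arrival with a departure. What
  remains is the departure of the earliest arc \<open>last T\<close> and the arrival of the latest
  arc \<open>hd T\<close>.\<close>

lemma walk_starts_ends:
  "T \<noteq> [] \<Longrightarrow> walk D T \<Longrightarrow> starts D T v - ends D T v =
    of_bool (D dvd v - src (last T)) - of_bool (D dvd v - dst (hd T))"
proof (induction T)
  case (Cons b T)
  show ?case
  proof (cases "T = []")
    case False
    then have b: "D dvd src b - dst (hd T)" using Cons.prems by (simp add: successively_Cons)
    have "v - dst (hd T) = (v - src b) + (src b - dst (hd T))" by simp
    then have "D dvd v - dst (hd T) \<longleftrightarrow> D dvd v - src b"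
      using b by (metis dvd_add_left_iff)
    then show ?thesis
      using Cons.IH Cons.prems False by (auto simp: successively_Cons starts_def ends_def)
  qed (simp add: starts_def ends_def)
qed simp

definition tour_inv :: "int \<Rightarrow> arc list \<Rightarrow> arc list \<times> arc list \<Rightarrow> bool" where
  "tour_inv D as s \<longleftrightarrow> fst s \<noteq> [] \<and> walk D (fst s) \<and> mset (fst s) + mset (snd s) = mset as"

text \<open>Looking at destinations suffices, because in a closed walk every source is also a
  destination.\<close>

definition stuck :: "int \<Rightarrow> arc list \<times> arc list \<Rightarrow> bool" where
  "stuck D s \<longleftrightarrow> (\<forall>t\<in>set (fst s). \<forall>a\<in>set (snd s). \<not> D dvd src a - dst t)"

lemma tour_step_cases:
  assumes "T \<noteq> []"
  obtains (extend) a R' where "tour_step D (T, R) = (a # T, R')" "D dvd src a - dst (hd T)"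
      "mset R = add_mset a (mset R')"
  | (rotate) "tour_step D (T, R) = (rotate1 T, R)" "\<forall>a\<in>set R. \<not> D dvd src a - dst (hd T)"
proof -
  obtain t T' where T: "T = t # T'" using assms by (cases T) auto
  let ?M = "\<lambda>a. (src a - dst t) mod D = 0"
  show ?thesis
  proof (cases "filter ?M R")
    case Nil
    then show ?thesis
      by (intro rotate) (auto simp: tour_step_def T filter_empty_conv dvd_eq_mod_eq_0)
  next
    case (Cons a as)
    have "mset R = mset (filter ?M R) + mset (filter (\<lambda>a. \<not> ?M a) R)"
      by simp
    then have "mset R = add_mset a (mset (as @ filter (\<lambda>a. \<not> ?M a) R))"
      unfolding Cons by simp
    moreover have "a \<in> set (filter ?M R)" unfolding Cons by simp
    then have "?M a" by simp
    ultimately show ?thesis using Cons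
      by (intro extend[of a "as @ filter (\<lambda>a. \<not> ?M a) R"]) (auto simp: tour_step_def T dvd_eq_mod_eq_0)
  qed
qed

lemma funpow_fold: "fold (\<lambda>_. f) ys s = (f ^^ length ys) s"
  by (induction ys arbitrary: s) (auto simp: funpow_swap1)

locale eulerian =
  fixes D :: int and as :: "arc list"
  assumes euler: "\<And>x. starts D as x = ends D as x" and as_nonempty: "as \<noteq> []"
begin

text \<open>At the end vertex all departures belong to the walk, while some arrivals may lie outside
  it. Since the degrees are equal, the walk departs from this vertex at least as often as it
  arrives, which by \<open>walk_starts_ends\<close> forces it to have begun there.\<close>

lemma blocked_imp_closed:
  assumes "tour_inv D as (T, R)" "\<forall>a\<in>set R. \<not> D dvd src a - dst (hd T)"
  shows "D dvd dst (hd T) - src (last T)"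
proof -
  let ?v = "dst (hd T)"
  have T: "T \<noteq> []" "walk D T" and m: "mset as = mset T + mset R"
    using assms(1) by (auto simp: tour_inv_def)
  have "starts D T ?v + starts D R ?v = ends D T ?v + ends D R ?v"
    using euler[of ?v] by (simp add: starts_mset ends_mset m)
  moreover have "starts D R ?v = 0"
    using assms(2) by (simp add: starts_def filter_empty_conv dvd_diff_commute)
  moreover have "ends D R ?v \<ge> 0" by (simp add: ends_def)
  ultimately show ?thesis using walk_starts_ends[OF T, of ?v] by (auto split: if_splits simp: of_bool_def)
qed

lemma tour_inv_step:
  assumes "tour_inv D as s"
  shows "tour_inv D as (tour_step D s)"
proof -
  obtain T R where s: "s = (T, R)" by (cases s)
  have T: "T \<noteq> []" "walk D T" and m: "mset T + mset R = mset as"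
    using assms by (auto simp: tour_inv_def s)
  from T(1) show ?thesis
  proof (cases rule: tour_step_cases[where D = D and R = R])
    case (extend a R')
    then show ?thesis using T m by (simp add: tour_inv_def s successively_Cons)
  next
    case rotate
    then have c: "D dvd dst (hd T) - src (last T)" using blocked_imp_closed assms s by simp
    obtain t T' where T': "T = t # T'" using T by (cases T) auto
    have "walk D (T' @ [t])"
    proof (cases "T' = []")
      case False
      then show ?thesis using T(2) c
        by (auto simp: T' successively_append_iff successively_Cons dvd_diff_commute)
    qed simp
    then show ?thesis using m rotate by (simp add: tour_inv_def s T')
  qed
qed

lemma tour_inv_funpow: "tour_inv D as s \<Longrightarrow> tour_inv D as ((tour_step D ^^ k) s)"
  by (induction k) (auto intro: tour_inv_step)

lemma length_rest_step:
  assumes "tour_inv D as s"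
  shows "length (snd (tour_step D s)) \<le> length (snd s)"
proof -
  obtain T R where s: "s = (T, R)" by (cases s)
  have "T \<noteq> []" using assms by (auto simp: tour_inv_def s)
  then show ?thesis
  proof (cases rule: tour_step_cases[where D = D and R = R])
    case (extend a R')
    then have "length R = Suc (length R')" by (metis size_mset size_add_mset)
    then show ?thesis using extend by (simp add: s)
  qed (simp add: s)
qed

lemma stuck_step:
  assumes "tour_inv D as s" "stuck D s"
  shows "tour_step D s = (rotate1 (fst s), snd s)" "stuck D (tour_step D s)"
proof -
  obtain T R where s: "s = (T, R)" by (cases s)
  have "T \<noteq> []" using assms by (auto simp: tour_inv_def s)
  then have "tour_step D s = (rotate1 (fst s), snd s)"
  proof (cases rule: tour_step_cases[where D = D and R = R])
    case (extend a R')
    then have "a \<in> set R" by (metis set_mset_mset union_single_eq_member)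
    then show ?thesis using extend assms(2) \<open>T \<noteq> []\<close> by (auto simp: stuck_def s)
  qed (simp add: s)
  then show "tour_step D s = (rotate1 (fst s), snd s)" "stuck D (tour_step D s)"
    using assms(2) by (auto simp: stuck_def)
qed

lemma stuck_funpow:
  assumes "tour_inv D as s" "stuck D s"
  shows "stuck D ((tour_step D ^^ k) s)"
  by (induction k) (use assms stuck_step(2) tour_inv_funpow in auto)

text \<open>Until the first extension, step \<open>i\<close> inspects the destination of
  \<open>T ! (i mod length T)\<close>, brought to the head by \<open>i\<close> rotations. After an
  extension the rest stays shorter for good.\<close>

lemma round_progress:
  assumes "tour_inv D as (T, R)"
  shows "length (snd ((tour_step D ^^ k) (T, R))) < length R \<or>
    (tour_step D ^^ k) (T, R) = (rotate k T, R) \<and>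
    (\<forall>i<k. \<forall>a\<in>set R. \<not> D dvd src a - dst (T ! (i mod length T)))"
proof (induction k)
  case (Suc k)
  have T: "T \<noteq> []" using assms by (auto simp: tour_inv_def)
  from Suc show ?case
  proof
    assume "length (snd ((tour_step D ^^ k) (T, R))) < length R"
    then show ?thesis
      using length_rest_step[OF tour_inv_funpow[OF assms, of k]] by (simp add: le_less_trans)
  next
    assume *: "(tour_step D ^^ k) (T, R) = (rotate k T, R) \<and>
      (\<forall>i<k. \<forall>a\<in>set R. \<not> D dvd src a - dst (T ! (i mod length T)))"
    have "rotate k T \<noteq> []" using T by simp
    then show ?thesis
    proof (cases rule: tour_step_cases[where D = D and R = R])
      case (extend a R')
      then have "length R = Suc (length R')" by (metis size_mset size_add_mset)
      then show ?thesis using extend * by simp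
    next
      case rotate
      then show ?thesis using * T by (auto simp: less_Suc_eq hd_rotate_conv_nth)
    qed
  qed
qed simp

lemma round:
  assumes "tour_inv D as s"
  shows "stuck D ((tour_step D ^^ length as) s) \<or>
    length (snd ((tour_step D ^^ length as) s)) < length (snd s)"
proof -
  obtain T R where s: "s = (T, R)" by (cases s)
  have "T \<noteq> []" and m: "mset T + mset R = mset as" using assms by (auto simp: tour_inv_def s)
  \<comment> \<open>A round has at least \<open>length T\<close> steps, so without an extension
    every arc of \<open>T\<close> is inspected.\<close>
  from m have len: "length T + length R = length as"
    by (metis size_mset size_union)
  {
    assume *: "(tour_step D ^^ length as) (T, R) = (rotate (length as) T, R)"
      "\<forall>i<length as. \<forall>a\<in>set R. \<not> D dvd src a - dst (T ! (i mod length T))"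
    have "\<not> D dvd src a - dst t" if t: "t \<in> set T" and a: "a \<in> set R" for a t
    proof -
      obtain i where "i < length T" "t = T ! i" using t by (metis in_set_conv_nth)
      then show ?thesis using *(2)[rule_format, of i a] a len by simp
    qed
    then have "stuck D ((tour_step D ^^ length as) s)" using * by (simp add: stuck_def s)
  }
  then show ?thesis using round_progress[of T R "length as"] assms by (auto simp: s)
qed

lemma tour_stuck: "tour_inv D as (tour D as)" "stuck D (tour D as)"
proof -
  obtain a R where as: "as = a # R" using as_nonempty by (cases as) auto
  let ?f = "tour_step D ^^ length as"
  have tour: "tour D as = (?f ^^ length as) ([a], R)"
  proof -
    have "fold (\<lambda>_. tour_step D) as = ?f" by (rule ext) (rule funpow_fold)
    moreover have "tour D as = fold (\<lambda>_. fold (\<lambda>_. tour_step D) as) as ([a], R)"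
      unfolding tour_def by (subst (2) as) simp
    ultimately show ?thesis by (simp add: funpow_fold)
  qed
  have init: "tour_inv D as ([a], R)" by (simp add: tour_inv_def as)
  have inv: "tour_inv D as ((?f ^^ k) ([a], R))" for k
    by (induction k) (use init tour_inv_funpow in auto)
  \<comment> \<open>A round that does not end stuck shortens the rest. At
    \<open>k = length as\<close>, one more than \<open>length R\<close>, only the first alternative
    is left.\<close>
  have "stuck D ((?f ^^ k) ([a], R)) \<or> length (snd ((?f ^^ k) ([a], R))) + k \<le> length R" for k
  proof (induction k)
    case (Suc k)
    then show ?case using round[OF inv[of k]] stuck_funpow[OF inv[of k]] by auto
  qed simp
  from this[of "length as"] show "stuck D (tour D as)" using arg_cong[OF as, of length] by (simp add: tour)
  show "tour_inv D as (tour D as)" by (simp add: tour inv)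
qed

lemma tour_closed: "D dvd dst (hd (fst (tour D as))) - src (last (fst (tour D as)))"
proof (rule blocked_imp_closed)
  show "tour_inv D as (fst (tour D as), snd (tour D as))" using tour_stuck(1) by simp
  then show "\<forall>a\<in>set (snd (tour D as)). \<not> D dvd src a - dst (hd (fst (tour D as)))"
    using tour_stuck(2) by (auto simp: stuck_def tour_inv_def)
qed

definition reached :: "int set" where
  "reached = (\<lambda>t. dst t mod D) ` set (fst (tour D as))"

lemma tour_starts_ends:
  "starts D (fst (tour D as)) v = ends D (fst (tour D as)) v"
  "starts D (snd (tour D as)) v = ends D (snd (tour D as)) v"
proof -
  obtain T R where s: "tour D as = (T, R)" by (cases "tour D as")
  have T: "T \<noteq> []" "walk D T" and m: "mset as = mset T + mset R"
    using tour_stuck(1) by (auto simp: tour_inv_def s)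
  have c: "D dvd dst (hd T) - src (last T)" using tour_closed s by simp
  have "v - src (last T) = (v - dst (hd T)) + (dst (hd T) - src (last T))" by simp
  then have "D dvd v - src (last T) \<longleftrightarrow> D dvd v - dst (hd T)"
    using c by (metis dvd_add_left_iff)
  then have 1: "starts D T v = ends D T v" using walk_starts_ends[OF T, of v] by simp
  moreover have "starts D T v + starts D R v = ends D T v + ends D R v"
    using euler[of v] by (simp add: starts_mset ends_mset m)
  ultimately show "starts D (fst (tour D as)) v = ends D (fst (tour D as)) v"
    "starts D (snd (tour D as)) v = ends D (snd (tour D as)) v" by (simp_all add: s)
qed

lemma ends_pos: "ends D bs v > 0 \<longleftrightarrow> (\<exists>a\<in>set bs. v mod D = dst a mod D)"
  by (auto simp: ends_def filter_empty_conv mod_eq_dvd_iff)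

lemma starts_pos: "starts D bs v > 0 \<longleftrightarrow> (\<exists>a\<in>set bs. v mod D = src a mod D)"
  by (auto simp: starts_def filter_empty_conv mod_eq_dvd_iff)

lemma reached_tour:
  assumes "t \<in> set (fst (tour D as))"
  shows "src t mod D \<in> reached \<and> dst t mod D \<in> reached"
proof -
  have "starts D (fst (tour D as)) (src t) > 0" using assms by (auto simp: starts_pos)
  then show ?thesis using assms by (auto simp: tour_starts_ends ends_pos reached_def)
qed

text \<open>By \<open>stuck\<close>, no leftover arc starts at a vertex of the tour. None ends there
  either: the leftover arcs have equal degrees by themselves, so another one would have to start at
  that vertex.\<close>

lemma not_reached_rest:
  assumes "a \<in> set (snd (tour D as))"
  shows "src a mod D \<notin> reached \<and> dst a mod D \<notin> reached"
proof -
  have *: "src b mod D \<notin> reached" if "b \<in> set (snd (tour D as))" for b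
    using tour_stuck(2) that by (auto simp: stuck_def reached_def mod_eq_dvd_iff)
  have "ends D (snd (tour D as)) (dst a) > 0" using assms by (auto simp: ends_pos)
  then obtain b where "b \<in> set (snd (tour D as))" "dst a mod D = src b mod D"
    by (auto simp: tour_starts_ends(2)[symmetric] starts_pos)
  then show ?thesis using *[OF assms] *[of b] by simp
qed

lemma set_tour: "set (fst (tour D as)) \<union> set (snd (tour D as)) = set as"
  using tour_stuck(1) by (metis set_mset_mset set_mset_union tour_inv_def)

lemma reached_iff: "a \<in> set as \<Longrightarrow> src a mod D \<in> reached \<longleftrightarrow> dst a mod D \<in> reached"
  using set_tour reached_tour not_reached_rest by blast

end

section \<open>Schedules and tours\<close>

text \<open>The quotient identifies the occurrence. It is part of the claim because an arc of length
  \<open>D\<close> covers every cell, and there only a change of the occurrence reveals that the arc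
  has ended.\<close>

lemma covers_next:
  assumes "0 < D" "dst a - src a \<le> D" "covers D x a"
  shows "covers D (x + 1) a \<and> (x + 1 - src a) div D = (x - src a) div D \<or> D dvd x + 1 - dst a"
proof (cases "(x - src a) mod D + 1 < dst a - src a")
  case True
  define m y where "m = (x - src a) div D" and "y = (x - src a) mod D"
  have x: "x + 1 - src a = (y + 1) + m * D" by (simp add: m_def y_def algebra_simps)
  have "0 \<le> y + 1" "y + 1 < D" using assms True by (auto simp: y_def)
  then show ?thesis using True assms(1) by (simp add: covers_def x m_def[symmetric] y_def[symmetric])
next
  case False
  then have "(x - src a) mod D + 1 = dst a - src a" using assms by (simp add: covers_def)
  then have "x + 1 - dst a = x - src a - (x - src a) mod D" by simp
  then have "D dvd x + 1 - dst a" using dvd_minus_mod by metis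
  then show ?thesis by blast
qed

lemma covers_prev:
  assumes "0 < D" "covers D (x + 1) a"
  shows "covers D x a \<and> (x + 1 - src a) div D = (x - src a) div D \<or> D dvd x + 1 - src a"
proof (cases "(x + 1 - src a) mod D = 0")
  case False
  define m y where "m = (x + 1 - src a) div D" and "y = (x + 1 - src a) mod D"
  have x: "x - src a = (y - 1) + m * D" by (simp add: m_def y_def algebra_simps)
  have "0 \<le> y" "y < D" using assms by (auto simp: y_def)
  then have "0 \<le> y - 1" "y - 1 < D" using False y_def by auto
  then show ?thesis using assms by (simp add: covers_def x m_def[symmetric] y_def[symmetric])
qed (simp add: dvd_eq_mod_eq_0)

locale schedule = int_tasks +
  fixes g :: "arc \<Rightarrow> nat \<Rightarrow> nat"
  assumes worker_range: "\<And>a r. a \<in> set ts \<Longrightarrow> r \<ge> 1 \<Longrightarrow> g a r \<in> {1..nat q}"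
    and no_conflict: "\<And>a b r r'. a \<in> set ts \<Longrightarrow> b \<in> set ts \<Longrightarrow> a \<noteq> b \<Longrightarrow> r \<ge> 1 \<Longrightarrow> r' \<ge> 1 \<Longrightarrow>
      src a + int r * D < dst b + int r' * D \<Longrightarrow> src b + int r' * D < dst a + int r * D \<Longrightarrow> g a r \<noteq> g b r'"
begin

definition occ :: "int \<Rightarrow> arc \<Rightarrow> nat" where
  "occ x a = nat ((x - src a) div D)"

definition doing :: "nat \<Rightarrow> int \<Rightarrow> arc \<Rightarrow> bool" where
  "doing j x a \<longleftrightarrow> a \<in> set ts \<and> covers D x a \<and> g a (occ x a) = j"

text \<open>Schedules are followed from time \<open>D\<close> on. Occurrence 0 of \<open>a\<close>
  would end at \<open>dst a \<le> D\<close>, so an occurrence covering a cell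
  \<open>x \<ge> D\<close> has a positive number, which is where the assignment is
  constrained.\<close>

lemma occ_bounds:
  assumes "a \<in> set ts" "covers D x a" "x \<ge> D"
  shows "occ x a \<ge> 1" "src a + int (occ x a) * D \<le> x" "x < dst a + int (occ x a) * D"
proof -
  define m y where "m = (x - src a) div D" and "y = (x - src a) mod D"
  have x: "x - src a = y + m * D" by (simp add: m_def y_def algebra_simps)
  have y: "0 \<le> y" "y < dst a - src a" using assms D_pos by (auto simp: y_def covers_def)
  have "m \<ge> 1"
  proof (rule ccontr)
    assume "\<not> m \<ge> 1"
    then have "m * D \<le> 0" using D_pos by (simp add: mult_nonpos_nonneg)
    then show False using x y task_bounds[OF assms(1)] assms(3) by linarith
  qed
  moreover have "int (occ x a) = m" using \<open>m \<ge> 1\<close> by (simp add: occ_def m_def)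
  ultimately show "occ x a \<ge> 1" "src a + int (occ x a) * D \<le> x" "x < dst a + int (occ x a) * D"
    using x y by auto
qed

lemma doing_unique:
  assumes "x \<ge> D" "doing j x a" "doing j x b"
  shows "a = b"
proof (rule ccontr)
  assume "a \<noteq> b"
  have a: "a \<in> set ts" "covers D x a" "g a (occ x a) = j" and b: "b \<in> set ts" "covers D x b" "g b (occ x b) = j"
    using assms by (auto simp: doing_def)
  note oa = occ_bounds[OF a(1,2) assms(1)] and ob = occ_bounds[OF b(1,2) assms(1)]
  have "g a (occ x a) \<noteq> g b (occ x b)"
    using no_conflict[OF a(1) b(1) \<open>a \<noteq> b\<close> oa(1) ob(1)] oa ob by linarith
  then show False using a b by simp
qed

lemma distinct_ts: "distinct ts"
proof -
  have "distinct (map fst ts)" by (simp add: tags)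
  then show ?thesis by (simp add: distinct_map)
qed

lemma load_card: "load D ts x = int (card {a \<in> set ts. covers D x a})"
proof -
  have "card {a \<in> set ts. covers D x a} = length (filter (covers D x) ts)"
    using distinct_card[of "filter (covers D x) ts"] distinct_ts by (simp add: conj_commute)
  then show ?thesis by (simp add: load_def)
qed

lemma load_le_card:
  assumes "x \<ge> D" "finite J" "\<And>a. a \<in> set ts \<Longrightarrow> covers D x a \<Longrightarrow> g a (occ x a) \<in> J"
  shows "load D ts x \<le> int (card J)"
proof -
  have "inj_on (\<lambda>a. g a (occ x a)) {a \<in> set ts. covers D x a}"
    using doing_unique[OF assms(1)] by (auto simp: inj_on_def doing_def)
  moreover have "(\<lambda>a. g a (occ x a)) ` {a \<in> set ts. covers D x a} \<subseteq> J" using assms by auto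
  ultimately show ?thesis using assms(2) by (simp add: load_card card_inj_on_le)
qed

lemma load_le_workers: "load D ts x \<le> q"
proof -
  \<comment> \<open>The equivalent cell in the range from \<open>D\<close> to
    \<open>2 * D - 1\<close>, where all running occurrences have positive numbers.\<close>
  define y where "y = x mod D + D"
  have y: "y \<ge> D" using D_pos by (simp add: y_def)
  have "load D ts y \<le> int (card {1..nat q})"
    using occ_bounds(1)[OF _ _ y] worker_range by (intro load_le_card[OF y]) auto
  moreover have "load D ts y = load D ts x"
    by (rule load_cong) (simp add: y_def mod_eq_dvd_iff[symmetric])
  ultimately show ?thesis using q_pos by simp
qed

lemma load_less_workers:
  assumes "x \<ge> D" "j \<in> {1..nat q}" "\<nexists>a. doing j x a"
  shows "load D ts x < q"
proof -
  have "load D ts x \<le> int (card ({1..nat q} - {j}))"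
  proof (rule load_le_card[OF assms(1)])
    fix a assume a: "a \<in> set ts" "covers D x a"
    then have "g a (occ x a) \<noteq> j" using assms(3) unfolding doing_def by blast
    then show "g a (occ x a) \<in> {1..nat q} - {j}"
      using worker_range[OF a(1) occ_bounds(1)[OF a assms(1)]] by simp
  qed simp
  also have "\<dots> < q" using assms(2) q_pos by (simp add: nat_diff_distrib)
  finally show ?thesis .
qed

text \<open>The class of a worker at cell \<open>x\<close> is that of the task being performed, or of \<open>x\<close> itself when
  the worker is idle. Going from \<open>x\<close> to \<open>x + 1\<close>, a worker either continues the same occurrence, or
  the classes before and after both equal the class of the point \<open>x + 1\<close>.\<close>

lemma worker_stays_in_class:
  fixes cls :: "int \<Rightarrow> bool"
  assumes per: "\<And>x y. D dvd x - y \<Longrightarrow> cls x = cls y"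
    and task: "\<And>a. a \<in> set ts \<Longrightarrow> cls (src a) = cls (dst a)"
    and idle: "\<And>x. load D ts x < q \<Longrightarrow> cls x = cls (x + 1)"
    and j: "j \<in> {1..nat q}"
    and a: "a \<in> set ts" "r \<ge> 1" "g a r = j" and b: "b \<in> set ts" "r' \<ge> 1" "g b r' = j"
  shows "cls (src a) = cls (src b)"
proof -
  define cl where "cl x \<longleftrightarrow> (\<exists>a. doing j x a \<and> cls (src a)) \<or> (\<nexists>a. doing j x a) \<and> cls x" for x
  have cl_doing: "cl x = cls (src a)" if "x \<ge> D" "doing j x a" for x a
    using that doing_unique[OF that(1)] unfolding cl_def by blast
  have step: "cl (x + 1) = cl x" if x: "x \<ge> D" for x
  proof (cases "\<exists>a. doing j x a \<and> doing j (x + 1) a")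
    case True
    then show ?thesis using cl_doing x by (metis add_increasing2 zero_le_one)
  next
    case False
    have "cl x = cls (x + 1)"
    proof (cases "\<exists>a. doing j x a")
      case True
      then obtain c where c: "doing j x c" by blast
      then have "\<not> doing j (x + 1) c" using False by blast
      then have "D dvd x + 1 - dst c"
        using covers_next[OF D_pos, of c x] c task_bounds[of c] by (auto simp: doing_def occ_def)
      then show ?thesis using per[of "x + 1" "dst c"] task[of c] c cl_doing[OF x c] by (simp add: doing_def)
    next
      case False
      then show ?thesis using idle[OF load_less_workers[OF x j False]] by (simp add: cl_def)
    qed
    moreover have "cl (x + 1) = cls (x + 1)"
    proof (cases "\<exists>a. doing j (x + 1) a")
      case True
      then obtain c where c: "doing j (x + 1) c" by blast
      then have "\<not> doing j x c" using False by blast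
      then have "D dvd x + 1 - src c"
        using covers_prev[OF D_pos, of x c] c by (auto simp: doing_def occ_def)
      then show ?thesis using per[of "x + 1" "src c"] cl_doing[OF _ c] x by simp
    qed (simp add: cl_def)
    ultimately show ?thesis by simp
  qed
  have const: "cl (D + int k) = cl D" for k
  proof (induction k)
    case (Suc k)
    then show ?case using step[of "D + int k"] by (simp add: algebra_simps)
  qed simp
  have "cls (src a) = cl D" if a: "a \<in> set ts" "r \<ge> 1" "g a r = j" for a r
  proof -
    \<comment> \<open>The last cell of occurrence \<open>r\<close> rather than the first: it lies at
      \<open>D\<close> or later because \<open>dst a > 0\<close>, whereas the first occurrence
      starts before \<open>D\<close> if \<open>src a\<close> is negative.\<close>
    define x where "x = dst a - 1 + int r * D"
    have bd: "src a < dst a" "dst a - src a \<le> D" "0 < dst a" using task_bounds[OF a(1)] by auto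
    have "1 * D \<le> int r * D" using a(2) D_pos by (intro mult_right_mono) auto
    then have x: "x \<ge> D" using bd unfolding x_def by linarith
    have e: "x - src a = (dst a - src a - 1) + int r * D" by (simp add: x_def)
    have "(x - src a) mod D = dst a - src a - 1" "(x - src a) div D = int r"
      using bd D_pos unfolding e by simp_all
    then have "doing j x a" using a by (simp add: doing_def covers_def occ_def)
    then have "cls (src a) = cl x" using cl_doing x by simp
    also have "\<dots> = cl D" using const[of "nat (x - D)"] x by simp
    finally show ?thesis .
  qed
  then show ?thesis using a b by blast
qed

text \<open>If an arc is left over, let the class of a cell tell whether its
  \<open>last_point\<close> lies on the tour. Neither tasks nor idle time lead from one class to the
  other, both classes contain tasks, and yet worker 1 performs all tasks.\<close>

lemma tour_complete:
  assumes "\<And>a. a \<in> set ts \<Longrightarrow> \<exists>r\<ge>1. g a r = 1"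
  shows "snd (tour D arcs) = []"
proof (rule ccontr)
  interpret eulerian D arcs
    by unfold_locales (use arcs_eulerian load_le_workers ts_nonempty in \<open>auto simp: all_arcs_def\<close>)
  assume "snd (tour D arcs) \<noteq> []"
  then obtain b where b: "b \<in> set (snd (tour D arcs))" by (cases "snd (tour D arcs)") auto
  have "fst (tour D arcs) \<noteq> []" using tour_stuck(1) by (simp add: tour_inv_def)
  then obtain a where a: "a \<in> set (fst (tour D arcs))" by (cases "fst (tour D arcs)") auto
  have ab: "a \<in> set arcs" "b \<in> set arcs" using a b set_tour by auto
  define cls where "cls x \<longleftrightarrow> last_point x \<in> reached" for x
  have ts_arcs: "c \<in> set arcs" if "c \<in> set ts" for c using that by (simp add: all_arcs_def)
  have cls_point: "cls x \<longleftrightarrow> x mod D \<in> reached" if "x mod D \<in> set P" for x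
    using that by (simp add: cls_def last_point_of_point)
  have ends: "src c mod D \<in> set P" "dst c mod D \<in> set P" if "c \<in> set arcs" for c
    using arcs_endpoints[OF that] by auto
  have per: "cls x = cls y" if "D dvd x - y" for x y
  proof -
    have "(x - u) mod D = (y - u) mod D" for u using that by (simp add: mod_eq_dvd_iff)
    then show ?thesis by (simp add: cls_def last_point_def)
  qed
  have task: "cls (src c) = cls (dst c)" if "c \<in> set ts" for c
    using reached_iff[OF ts_arcs[OF that]] ends[OF ts_arcs[OF that]] by (simp add: cls_point)
  \<comment> \<open>Below full load some idle arc lies over \<open>x\<close>. It joins
    \<open>u\<close> to the next point, so both have the same class, and \<open>x + 1\<close> is
    either still in the gap after \<open>u\<close> or is that next point modulo
    \<open>D\<close>.\<close>
  have idle: "cls x = cls (x + 1)" if "load D ts x < q" for x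
  proof -
    define u where "u = last_point x"
    have u: "u \<in> set P" "(x - u) mod D < len u" using last_point[of x] by (auto simp: u_def)
    have "(0, u, u + len u) \<in> set arcs"
      using idle_arc_in_arcs[OF u(1)] that load_last_point[of x] by (simp add: u_def)
    from reached_iff[OF this] have iff: "u \<in> reached \<longleftrightarrow> (u + len u) mod D \<in> reached"
      using points_bounds[OF u(1)] by simp
    have "covers D x (0, u, u + len u)" using u(2) by (simp add: covers_def)
    from covers_next[OF D_pos _ this] len_bounds[of u]
    have "(x + 1 - u) mod D < len u \<or> D dvd x + 1 - (u + len u)" by (auto simp: covers_def)
    then show ?thesis
    proof
      assume "(x + 1 - u) mod D < len u"
      then have "last_point (x + 1) = u" using u(1) by (intro last_point_eqI)
      then show ?thesis by (simp add: cls_def u_def)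
    next
      assume *: "D dvd x + 1 - (u + len u)"
      then have "cls (x + 1) \<longleftrightarrow> cls (u + len u)" by (rule per)
      also have "\<dots> \<longleftrightarrow> u \<in> reached" using iff len_add[of u] by (simp add: cls_point)
      finally show ?thesis by (simp add: cls_def u_def)
    qed
  qed
  \<comment> \<open>Every point is an endpoint of a task. Hence even a leftover idle arc yields a
    task outside the tour, and any arc of the tour yields one inside.\<close>
  have task_at: "\<exists>c\<in>set ts. cls (src c) = (v \<in> reached)" if "v \<in> set P" for v
  proof -
    obtain c where c: "c \<in> set ts" "v = src c mod D \<or> v = dst c mod D"
      using \<open>v \<in> set P\<close> by (auto simp: set_points)
    then show ?thesis using task[OF c(1)] ends[OF ts_arcs[OF c(1)]] by (metis cls_point)
  qed
  obtain c d where c: "c \<in> set ts" "cls (src c)" and d: "d \<in> set ts" "\<not> cls (src d)"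
    using task_at[OF ends(1)[OF ab(1)]] task_at[OF ends(1)[OF ab(2)]]
      reached_tour[OF a] not_reached_rest[OF b] by blast
  obtain r r' where "r \<ge> 1" "g c r = 1" "r' \<ge> 1" "g d r' = 1" using assms c d by blast
  then have "cls (src c) = cls (src d)"
    using q_pos worker_stays_in_class[of cls 1 c r d r', OF per task idle] c(1) d(1) by simp
  then show False using c d by simp
qed

end

section \<open>Offsets read off a complete tour\<close>

lemma acc_map_append:
  "acc_map d g p (xs @ ys) = acc_map d g p xs @ acc_map d g (p + sum_list (map d xs)) ys"
  by (induction xs arbitrary: p) (auto simp: algebra_simps)

text \<open>Consecutive arcs match modulo \<open>D\<close>, so the unrolled position agrees with the
  source of the arc reached. This makes the division in \<open>offsets\<close> exact.\<close>

lemma walk_position: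
  assumes "successively (\<lambda>x y. D dvd src y - dst x) (xs @ a # ys)"
  shows "D dvd src (hd (xs @ a # ys)) + (\<Sum>x\<leftarrow>xs. dst x - src x) - src a"
  using assms
proof (induction xs)
  case (Cons x xs)
  let ?h = "src (hd (xs @ a # ys))"
  have "D dvd ?h - dst x" using Cons.prems by (simp add: successively_Cons)
  moreover have "D dvd ?h + (\<Sum>x\<leftarrow>xs. dst x - src x) - src a"
    using Cons by (simp add: successively_Cons)
  ultimately have "D dvd (?h + (\<Sum>x\<leftarrow>xs. dst x - src x) - src a) - (?h - dst x)" by (rule dvd_diff[rotated])
  then show ?case by (simp add: algebra_simps)
qed simp

lemma assoc_val_unique:
  assumes "i \<notin> fst ` set vs"
  shows "assoc_val (us @ (i, k) # vs) i = k"
proof -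
  have "fold (\<lambda>y s. if fst y = i then snd y else s) vs k = k"
    using assms by (induction vs) auto
  then show ?thesis by (simp add: assoc_val_def)
qed

lemma fst_acc_map: "map fst (acc_map d (\<lambda>p a. (fst a, h p a)) p xs) = map fst xs"
  by (induction xs arbitrary: p) auto

context int_tasks
begin

text \<open>Idle arcs have tag 0, and the tags of tasks are positive and distinct. So the last entry
  that \<open>assoc_val\<close> finds for a task is its own.\<close>

lemma arcs_tag_unique:
  assumes "mset T = mset arcs" "T = xs @ a # ys" "a \<in> set ts"
  shows "fst a \<notin> fst ` set ys"
proof -
  have tag: "fst a \<noteq> 0"
  proof -
    have "fst a \<in> set (map fst ts)" using assms(3) by simp
    then show ?thesis unfolding tags by auto
  qed
  have "distinct (map fst ts)" by (simp add: tags)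
  then have "count (mset (map fst ts)) (fst a) = 1"
    using assms(3) by (simp add: distinct_count_atmost_1)
  moreover have "fst a \<notin> set (map fst (idle_arcs D q ts P))"
    using tag by (auto simp: idle_arcs_eq)
  then have "count (mset (map fst (idle_arcs D q ts P))) (fst a) = 0" by (simp only: count_eq_zero_iff set_mset_mset) simp
  ultimately have "count (image_mset fst (mset arcs)) (fst a) = 1"
    by (simp add: all_arcs_def)
  then have "count (image_mset fst (mset T)) (fst a) = 1" by (simp add: assms(1))
  then have "count (mset (map fst xs)) (fst a) + Suc (count (mset (map fst ys)) (fst a)) = 1"
    by (simp add: assms(2))
  then have "count (mset (map fst ys)) (fst a) = 0" by simp
  then show ?thesis by (simp only: count_eq_zero_iff set_mset_mset set_map) simp
qed

text \<open>Unrolled, the arcs of the tour lie one after another in a window of length at most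
  \<open>D * q\<close>. If two overlapping occurrences had equal residues, the place of one task
  would meet that of another after a shift by a multiple of \<open>D * q\<close>, which a window of
  this length does not allow.\<close>

lemma offsets_disjoint:
  assumes load: "\<And>u. u \<in> set P \<Longrightarrow> load D ts u \<le> q" and complete: "snd (tour D arcs) = []"
    and ks: "ks = offsets D (rev (fst (tour D arcs)))"
    and a: "a \<in> set ts" and b: "b \<in> set ts" and ne: "a \<noteq> b"
    and overlap: "src a + r * D < dst b + r' * D" "src b + r' * D < dst a + r * D"
  shows "(r - assoc_val ks (fst a)) mod q \<noteq> (r' - assoc_val ks (fst b)) mod q"
proof -
  interpret eulerian D arcs
    by unfold_locales (use arcs_eulerian load ts_nonempty in \<open>auto simp: all_arcs_def\<close>)
  define T where "T = rev (fst (tour D arcs))"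
  have T: "T \<noteq> []" "mset T = mset arcs" "successively (\<lambda>x y. D dvd src y - dst x) T"
    using tour_stuck(1) complete by (auto simp: tour_inv_def T_def)
  define p where "p = src (hd T)"
  have offs: "offsets D T = acc_map (\<lambda>a. dst a - src a) (\<lambda>p a. (fst a, (p - src a) div D)) p T"
    using T(1) by (cases T) (auto simp: offsets_def p_def)
  let ?L = "\<lambda>xs. \<Sum>x\<leftarrow>xs. dst x - src x"
  have len: "src x < dst x" if "x \<in> set T" for x
    using that arcs_len[of x] mset_eq_setD[OF T(2)] by simp
  have nonneg: "?L xs \<ge> 0" if "set xs \<subseteq> set T" for xs
    using that len by (intro sum_list_nonneg) (auto simp: less_imp_le)
  have "?L xs = (\<Sum>x\<in>#mset xs. dst x - src x)" for xs by (induction xs) auto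
  then have "?L T = ?L arcs" by (simp only: T(2))
  then have total: "?L T \<le> D * q"
    using arcs_total_length[OF load] D_pos by (simp add: capacity_def)
  have offset: "p + ?L xs = src a + D * assoc_val ks (fst a)" if "T = xs @ a # ys" "a \<in> set ts" for xs a ys
  proof -
    have ks_split: "ks = acc_map (\<lambda>a. dst a - src a) (\<lambda>p a. (fst a, (p - src a) div D)) p xs @
        (fst a, (p + ?L xs - src a) div D) #
        acc_map (\<lambda>a. dst a - src a) (\<lambda>p a. (fst a, (p - src a) div D)) (p + ?L xs + (dst a - src a)) ys"
      (is "_ = ?U @ _ # ?V")
    proof -
      have "ks = acc_map (\<lambda>a. dst a - src a) (\<lambda>p a. (fst a, (p - src a) div D)) p T"
        using ks offs by (simp add: T_def)
      then show ?thesis unfolding that(1) by (simp add: acc_map_append)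
    qed
    have "fst ` set ?V = fst ` set ys" by (simp only: fst_acc_map flip: set_map)
    then have "fst a \<notin> fst ` set ?V" using arcs_tag_unique[OF T(2) that] by blast
    then have "assoc_val ks (fst a) = (p + ?L xs - src a) div D"
      unfolding ks_split by (rule assoc_val_unique)
    moreover have "D dvd p + ?L xs - src a"
      using walk_position[of D xs a ys] T(3) by (simp add: p_def that(1))
    ultimately show ?thesis by simp
  qed
  \<comment> \<open>By symmetry it suffices to treat the case that \<open>a\<close> comes before
    \<open>b\<close> in the tour.\<close>
  have main: "(r - assoc_val ks (fst a)) mod q \<noteq> (r' - assoc_val ks (fst b)) mod q"
    if split: "T = xs @ a # ys @ b # zs" and ab: "a \<in> set ts" "b \<in> set ts"
      and overlap: "src a + r * D < dst b + r' * D" "src b + r' * D < dst a + r * D"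
    for xs ys zs a b r r'
  proof
    let ?k = "assoc_val ks (fst a)" and ?k' = "assoc_val ks (fst b)"
    assume "(r - ?k) mod q = (r' - ?k') mod q"
    then obtain c where c: "(r - ?k) - (r' - ?k') = q * c" by (auto simp: mod_eq_dvd_iff)
    then have "r = r' - ?k' + ?k + q * c" by linarith
    then have "r * D = (r' - ?k' + ?k + q * c) * D" by (rule arg_cong)
    then have r: "r * D = r' * D - D * ?k' + D * ?k + D * (q * c)" by (simp add: algebra_simps)
    have pa: "p + ?L xs = src a + D * ?k" using offset[OF split ab(1)] .
    have pb: "p + ?L xs + (dst a - src a) + ?L ys = src b + D * ?k'"
      using offset[of "xs @ a # ys" b zs] split ab(2) by simp
    have "?L xs \<ge> 0" "?L ys \<ge> 0" "?L zs \<ge> 0" using split by (auto intro!: nonneg)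
    moreover have "?L xs + (dst a - src a) + ?L ys + (dst b - src b) + ?L zs \<le> D * q"
      using total by (simp add: split)
    \<comment> \<open>The overlap puts \<open>D * (q * c)\<close> strictly above the distance in the
      tour from the end of \<open>a\<close> to the start of \<open>b\<close>, and strictly below
      that from the start of \<open>a\<close> to the end of \<open>b\<close>.\<close>
    ultimately have 1: "0 < D * (q * c)" and 2: "D * (q * c) < D * q"
      using overlap pa pb r by linarith+
    from 1 have "c > 0" using D_pos q_pos by (simp add: zero_less_mult_iff)
    moreover from 2 have "q * c < q * 1" using D_pos by simp
    then have "c < 1" using q_pos by (simp only: mult_less_cancel_left_pos)
    ultimately show False by simp
  qed
  have "a \<in> set T" "b \<in> set T" using a b mset_eq_setD[OF T(2)] by (auto simp: all_arcs_def)
  then obtain xs ys where split: "T = xs @ a # ys" by (auto dest: split_list)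
  have "b \<in> set xs \<or> b \<in> set ys" using \<open>b \<in> set T\<close> ne split by auto
  then show ?thesis
  proof
    assume "b \<in> set xs"
    then obtain us vs where "xs = us @ b # vs" by (auto dest: split_list)
    then show ?thesis using main[of us b vs a ys] split a b overlap by fastforce
  next
    assume "b \<in> set ys"
    then obtain us vs where "ys = us @ b # vs" by (auto dest: split_list)
    then show ?thesis using main[of xs a us b vs] split a b overlap by blast
  qed
qed

end

section \<open>Correctness on instances\<close>

text \<open>Exactly one of the \<open>q\<close> integers after \<open>t\<close> lies in the residue
  class; \<open>m\<close> is its distance from \<open>t + 1\<close>.\<close>

lemma card_residue_add_period:
  fixes q k c :: int
  assumes "q > 0" "0 \<le> c" "c < q"
  shows "card {r \<in> {1..t + nat q}. (int r - k) mod q = c} = card {r \<in> {1..t}. (int r - k) mod q = c} + 1"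
proof -
  define m where "m = (c + k - int t - 1) mod q"
  define r0 where "r0 = t + 1 + nat m"
  have m: "0 \<le> m" "m < q" using assms by (auto simp: m_def)
  have r0: "int r0 = int t + 1 + m" using m by (simp add: r0_def)
  have "{r \<in> {t + 1..t + nat q}. (int r - k) mod q = c} = {r0}"
  proof (intro equalityI subsetI)
    fix r assume "r \<in> {r \<in> {t + 1..t + nat q}. (int r - k) mod q = c}"
    then have r: "int t + 1 \<le> int r" "int r \<le> int t + q" "(int r - k) mod q = c" using assms by auto
    have "m = (c + (k - int t - 1)) mod q" by (simp add: m_def algebra_simps)
    also have "\<dots> = (int r - k + (k - int t - 1)) mod q"
      unfolding r(3)[symmetric] by (rule mod_add_left_eq)
    also have "\<dots> = int r - int t - 1" using r by simp
    finally show "r \<in> {r0}" using r0 by simp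
  next
    fix r assume "r \<in> {r0}"
    then have r: "r = r0" by simp
    have "(int r0 - k) mod q = ((int t + 1 - k) + m) mod q" by (simp add: r0 algebra_simps)
    also have "\<dots> = ((int t + 1 - k) + (c + k - int t - 1)) mod q"
      unfolding m_def by (rule mod_add_right_eq)
    also have "\<dots> = c" using assms by simp
    finally show "r \<in> {r \<in> {t + 1..t + nat q}. (int r - k) mod q = c}" using r r0 m by auto
  qed
  moreover have "{r \<in> {1..t + nat q}. (int r - k) mod q = c}
      = {r \<in> {1..t}. (int r - k) mod q = c} \<union> {r \<in> {t + 1..t + nat q}. (int r - k) mod q = c}"
    by auto
  ultimately have "{r \<in> {1..t + nat q}. (int r - k) mod q = c} = {r \<in> {1..t}. (int r - k) mod q = c} \<union> {r0}"
    by simp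
  moreover have "r0 \<notin> {r \<in> {1..t}. (int r - k) mod q = c}" by (simp add: r0_def)
  ultimately show ?thesis by simp
qed

text \<open>For \<open>t = s + n * q\<close> with \<open>s < q\<close> the count is \<open>n\<close>
  plus at most \<open>q\<close>, so \<open>q * h t\<close> differs from \<open>t\<close> by an
  amount bounded in terms of \<open>q\<close> alone.\<close>

lemma residue_frequency:
  fixes q k c :: int
  assumes "q > 0" "0 \<le> c" "c < q"
  shows "(\<lambda>t. real (card {r \<in> {1..t}. (int r - k) mod q = c}) / real t) \<longlonglongrightarrow> 1 / real_of_int q"
proof -
  define h where "h t = card {r \<in> {1..t}. (int r - k) mod q = c}" for t
  have h_le: "h t \<le> t" for t
  proof -
    have "h t \<le> card {1..t}" unfolding h_def by (rule card_mono) auto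
    then show ?thesis by simp
  qed
  have h_mult: "h (s + n * nat q) = h s + n" for s n
  proof (induction n)
    case (Suc n)
    have "h (s + n * nat q + nat q) = h (s + n * nat q) + 1"
      unfolding h_def by (rule card_residue_add_period[OF assms])
    then show ?case using Suc by (simp add: algebra_simps)
  qed simp
  have bounds: "real t - q \<le> q * real (h t)" "q * real (h t) \<le> real t + q * q" for t
  proof -
    define s n where "s = t mod nat q" and "n = t div nat q"
    have s: "s < nat q" using assms by (simp add: s_def)
    have t: "t = s + n * nat q" by (simp add: s_def n_def)
    have ht: "h t = h s + n" unfolding t by (rule h_mult)
    have rt: "real t = real s + real n * q" using assms by (simp add: t)
    have "real s \<le> q" "real (h s) \<le> q" using s h_le[of s] assms by linarith+
    then have "q * real (h s) \<le> q * real_of_int q" "0 \<le> q * real (h s)" using assms by (auto intro!: mult_left_mono)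
    then show "real t - q \<le> q * real (h t)" "q * real (h t) \<le> real t + q * q"
      using \<open>real s \<le> q\<close> unfolding ht rt of_nat_add distrib_left of_int_mult
      by (simp_all only: mult.commute)
  qed
  have "(\<lambda>t. real (h t) / real t) \<longlonglongrightarrow> 1 / real_of_int q"
  proof (rule tendsto_sandwich)
    show "\<forall>\<^sub>F t in sequentially. 1 / real_of_int q - 1 / real t \<le> real (h t) / real t"
      using eventually_gt_at_top[of 0]
    proof eventually_elim
      case (elim t)
      have "1 / real_of_int q - 1 / real t = (real t - q) / (q * real t)"
        "real (h t) / real t = (q * real (h t)) / (q * real t)"
        using elim assms by (simp_all add: field_simps)
      then show ?case using divide_right_mono[OF bounds(1)[of t], of "q * real t"] assms by simp
    qed
    show "\<forall>\<^sub>F t in sequentially. real (h t) / real t \<le> 1 / real_of_int q + real_of_int q / real t"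
      using eventually_gt_at_top[of 0]
    proof eventually_elim
      case (elim t)
      have "1 / real_of_int q + real_of_int q / real t = (real t + q * q) / (q * real t)"
        "real (h t) / real t = (q * real (h t)) / (q * real t)"
        using elim assms by (simp_all add: field_simps)
      then show ?case using divide_right_mono[OF bounds(2)[of t], of "q * real t"] assms by simp
    qed
    show "(\<lambda>t. 1 / real_of_int q - 1 / real t) \<longlonglongrightarrow> 1 / real_of_int q"
      using tendsto_diff[OF tendsto_const lim_const_over_n[of 1]] by simp
    show "(\<lambda>t. 1 / real_of_int q + real_of_int q / real t) \<longlonglongrightarrow> 1 / real_of_int q"
      using tendsto_add[OF tendsto_const lim_const_over_n[of "real_of_int q"]] by simp
  qed
  then show ?thesis by (simp add: h_def)
qed

section \<open>From rational instances to scaled integer tasks\<close>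

definition raw_tasks :: "task_instance \<Rightarrow> raw_task list" where
  "raw_tasks I = map (\<lambda>i. (quotient_of (start I i), quotient_of (finish I i))) [1..<Suc (ntasks I)]"

text \<open>The instance as a value of an encodable type, arranged so that its code is literally
  \<open>encode_instance I\<close> and the \<open>ptime\<close> results apply.\<close>

definition input :: "task_instance \<Rightarrow> int \<times> int \<times> raw_task list" where
  "input I = (int (ntasks I), int (workers I), raw_tasks I)"

lemma enc_input: "enc (input I) = encode_instance I"
  by (simp add: input_def raw_tasks_def encode_instance_def encode_rat_def enc_defs comp_def
      del: upt_Suc)

lemma denom_prod: "denom rs = (\<Prod>r\<leftarrow>rs. snd (fst r) * snd (snd r))"
proof -
  have "fold (\<lambda>r p. p * (snd (fst r) * snd (snd r))) rs p = p * (\<Prod>r\<leftarrow>rs. snd (fst r) * snd (snd r))"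
    for p :: int and rs :: "raw_task list"
    by (induction rs arbitrary: p) (auto simp: algebra_simps)
  then show ?thesis by (simp add: denom_def)
qed

lemma prod_list_pos: "(\<And>x. x \<in> set xs \<Longrightarrow> 0 < x) \<Longrightarrow> 0 < prod_list xs" for xs :: "int list"
  by (induction xs) auto

lemma acc_map_upt: "acc_map (\<lambda>_. 1) h (int p) (map f [p..<p + k]) = map (\<lambda>i. h (int i) (f i)) [p..<p + k]"
proof (induction k arbitrary: p)
  case (Suc k)
  have "[p..<p + Suc k] = p # [Suc p..<Suc p + k]" by (simp add: upt_rec)
  then show ?case using Suc[of "Suc p"] by (simp add: add.commute)
qed simp

context
  fixes I :: task_instance
  assumes I: "is_instance I"
begin

definition scale :: int where
  "scale = denom (raw_tasks I)"

definition scaled_start :: "nat \<Rightarrow> int" where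
  "scaled_start i = fst (quotient_of (start I i)) * (scale div snd (quotient_of (start I i)))"

definition scaled_finish :: "nat \<Rightarrow> int" where
  "scaled_finish i = fst (quotient_of (finish I i)) * (scale div snd (quotient_of (finish I i)))"

lemma scale_pos: "scale > 0"
proof -
  have "0 < (\<Prod>r\<leftarrow>raw_tasks I. snd (fst r) * snd (snd r))"
    by (rule prod_list_pos) (auto simp: raw_tasks_def quotient_of_denom_pos')
  then show ?thesis by (simp add: scale_def denom_prod)
qed

lemma dvd_scale:
  assumes "i \<in> {1..ntasks I}"
  shows "snd (quotient_of (start I i)) dvd scale" "snd (quotient_of (finish I i)) dvd scale"
proof -
  have "snd (quotient_of (start I i)) * snd (quotient_of (finish I i))
      \<in> set (map (\<lambda>r. snd (fst r) * snd (snd r)) (raw_tasks I))"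
    using assms by (auto simp: raw_tasks_def simp del: upt_Suc)
  then have "snd (quotient_of (start I i)) * snd (quotient_of (finish I i)) dvd scale"
    unfolding scale_def denom_prod by (rule prod_list_dvd)
  then show "snd (quotient_of (start I i)) dvd scale" "snd (quotient_of (finish I i)) dvd scale"
    by (auto dest: dvd_mult_left dvd_mult_right)
qed

lemma scaled_rat:
  assumes "snd (quotient_of x) dvd scale"
  shows "rat_of_int (fst (quotient_of x) * (scale div snd (quotient_of x))) = x * of_int scale"
proof -
  obtain a b where ab: "quotient_of x = (a, b)" by (cases "quotient_of x")
  have x: "x = of_int a / of_int b" and b: "b > 0"
    using quotient_of_div[OF ab] quotient_of_denom_pos[OF ab] by auto
  obtain c where "scale = b * c" using assms ab by auto
  then have "rat_of_int (a * (scale div b)) = x * of_int scale" using b by (simp add: x)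
  then show ?thesis by (simp add: ab)
qed

lemma scaled_endpoints:
  assumes "i \<in> {1..ntasks I}"
  shows "of_int (scaled_start i) = start I i * of_int scale" "of_int (scaled_finish i) = finish I i * of_int scale"
  using scaled_rat dvd_scale[OF assms] by (auto simp: scaled_start_def scaled_finish_def)

lemma scaled_real:
  assumes "i \<in> {1..ntasks I}"
  shows "real_of_rat (start I i) = scaled_start i / scale" "real_of_rat (finish I i) = scaled_finish i / scale"
proof -
  have "real_of_rat (of_int (scaled_start i)) = real_of_rat (start I i) * of_int scale"
    "real_of_rat (of_int (scaled_finish i)) = real_of_rat (finish I i) * of_int scale"
    unfolding scaled_endpoints[OF assms] by (simp_all add: of_rat_mult)
  then show "real_of_rat (start I i) = scaled_start i / scale" "real_of_rat (finish I i) = scaled_finish i / scale"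
    using scale_pos by (simp_all add: field_simps)
qed

lemma scaled_tasks_eq:
  "scaled_tasks (raw_tasks I) = map (\<lambda>i. (int i, scaled_start i, scaled_finish i)) [1..<Suc (ntasks I)]"
  using acc_map_upt[of "\<lambda>i r. (i, fst (fst r) * (scale div snd (fst r)),
     fst (snd r) * (scale div snd (snd r)))" 1
     "\<lambda>i. (quotient_of (start I i), quotient_of (finish I i))" "ntasks I"]
  by (simp add: scaled_tasks_def raw_tasks_def[symmetric] scale_def[symmetric] scaled_start_def scaled_finish_def del: upt_Suc)
    (simp add: raw_tasks_def del: upt_Suc)

lemma scaled_bounds:
  assumes "i \<in> {1..ntasks I}"
  shows "scaled_start i < scaled_finish i" "scaled_finish i - scaled_start i \<le> scale" "0 < scaled_finish i" "scaled_finish i \<le> scale"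
proof -
  have *: "task_interval I i \<noteq> {}" "0 < finish I i" "finish I i \<le> 1" "finish I i - start I i \<le> 1"
    using I assms by (auto simp: is_instance_def)
  have D: "(0::rat) < of_int scale" using scale_pos by simp
  have "start I i < finish I i" using *(1) by (simp add: task_interval_def of_rat_less)
  then have "rat_of_int (scaled_start i) < of_int (scaled_finish i)" unfolding scaled_endpoints[OF assms] using D by simp
  then show "scaled_start i < scaled_finish i" by simp
  have "(finish I i - start I i) * of_int scale \<le> 1 * of_int scale"
    using *(4) D by (intro mult_right_mono) auto
  then have "rat_of_int (scaled_finish i - scaled_start i) \<le> of_int scale" by (simp add: scaled_endpoints[OF assms] algebra_simps)
  then show "scaled_finish i - scaled_start i \<le> scale" by (simp only: of_int_le_iff)
  have "rat_of_int (scaled_finish i) > 0" unfolding scaled_endpoints[OF assms] using *(2) D by simp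
  then show "0 < scaled_finish i" by simp
  have "finish I i * of_int scale \<le> 1 * of_int scale"
    using *(3) D by (intro mult_right_mono) auto
  then have "rat_of_int (scaled_finish i) \<le> of_int scale" by (simp add: scaled_endpoints[OF assms])
  then show "scaled_finish i \<le> scale" by simp
qed

text \<open>Nonempty half-open intervals meet exactly when each begins before the other ends, and
  multiplication by \<open>scale\<close> preserves these strict inequalities.\<close>

lemma overlap_iff:
  assumes i: "i \<in> {1..ntasks I}" and j: "j \<in> {1..ntasks I}"
  shows "occurrence I i r \<inter> occurrence I j r' \<noteq> {} \<longleftrightarrow>
    scaled_start i + int r * scale < scaled_finish j + int r' * scale \<and> scaled_start j + int r' * scale < scaled_finish i + int r * scale"
proof -
  have D: "real_of_int scale > 0" using scale_pos by simp
  have less: "real_of_int a / scale + real m < real_of_int b / scale + real n \<longleftrightarrow>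
      a + int m * scale < b + int n * scale" for a b m n
  proof -
    have add: "real_of_int a / scale + real m = real_of_int (a + int m * scale) / scale" for a m
      using D by (simp add: field_simps)
    show ?thesis unfolding add using D by (simp only: divide_less_cancel of_int_less_iff) simp
  qed
  have inter: "{a..<b} \<inter> {c..<d} \<noteq> {} \<longleftrightarrow> a < d \<and> c < b" if "a < b" "c < d" for a b c d :: real
    using that by (auto simp: max_def min_def)
  have "scaled_start i + int r * scale < scaled_finish i + int r * scale" "scaled_start j + int r' * scale < scaled_finish j + int r' * scale"
    using scaled_bounds(1)[OF i] scaled_bounds(1)[OF j] by simp_all
  then show ?thesis
    unfolding occurrence_def scaled_real[OF i] scaled_real[OF j] by (subst inter) (simp_all only: less)
qed

abbreviation "tasks \<equiv> scaled_tasks (raw_tasks I)"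

lemma set_tasks: "set tasks = (\<lambda>i. (int i, scaled_start i, scaled_finish i)) ` {1..ntasks I}"
  by (auto simp: scaled_tasks_eq simp del: upt_Suc)

lemma int_tasks: "int_tasks scale (int (workers I)) tasks"
proof
  show "0 < scale" by (rule scale_pos)
  show "0 < int (workers I)" "tasks \<noteq> []" using I by (auto simp: is_instance_def scaled_tasks_eq)
  have "map int [1..<Suc (ntasks I)] = [1..int (ntasks I)]"
    by (rule nth_equalityI) (auto simp del: upt_Suc)
  then show "map fst tasks = [1..int (length tasks)]" by (simp add: scaled_tasks_eq comp_def del: upt_Suc)
  show "src a < dst a \<and> dst a - src a \<le> scale \<and> 0 < dst a \<and> dst a \<le> scale" if "a \<in> set tasks" for a
    using that scaled_bounds by (auto simp: set_tasks)
qed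

lemma decide_fun_iff:
  "decide_fun (input I) \<longleftrightarrow> (\<forall>u\<in>set (points scale tasks). load scale tasks u \<le> int (workers I)) \<and>
     snd (tour scale (all_arcs scale (int (workers I)) tasks)) = []"
  by (auto simp: decide_fun_def input_def Let_def scale_def[symmetric] list_all_iff split: list.split)

lemma decide_fun_complete:
  assumes "balanced_feasible_assignment I f"
  shows "decide_fun (input I)"
proof -
  let ?q = "workers I"
  let ?g = "\<lambda>a. f (nat (fst a))"
  have f: "is_assignment I f" "feasible I f" "balanced I f"
    using assms by (auto simp: balanced_feasible_assignment_def)
  interpret int_tasks scale "int ?q" tasks by (rule int_tasks)
  interpret schedule scale "int ?q" tasks ?g
  proof
    show "?g a r \<in> {1..nat (int ?q)}" if "a \<in> set tasks" "1 \<le> r" for a r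
      using that f(1) by (auto simp: set_tasks is_assignment_def)
    show "?g a r \<noteq> ?g b r'" if ab: "a \<in> set tasks" "b \<in> set tasks" "a \<noteq> b" "1 \<le> r" "1 \<le> r'"
      "src a + int r * scale < dst b + int r' * scale" "src b + int r' * scale < dst a + int r * scale"
      for a b r r'
    proof -
      obtain i j where ij: "i \<in> {1..ntasks I}" "j \<in> {1..ntasks I}"
        "a = (int i, scaled_start i, scaled_finish i)" "b = (int j, scaled_start j, scaled_finish j)" using ab(1,2) by (auto simp: set_tasks)
      then have "i \<noteq> j" "occurrence I i r \<inter> occurrence I j r' \<noteq> {}"
        using ab by (auto simp: overlap_iff)
      then show ?thesis using f(2) ij ab(4,5) by (auto simp: feasible_def)
    qed
  qed
  have "\<exists>r\<ge>1. ?g a r = 1" if a: "a \<in> set tasks" for a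
  proof (rule ccontr)
    obtain i where i: "i \<in> {1..ntasks I}" "a = (int i, scaled_start i, scaled_finish i)" using a by (auto simp: set_tasks)
    \<comment> \<open>A task that worker 1 never performs would have limit frequency 0 there instead
      of \<open>1 / q\<close>.\<close>
    assume "\<not> (\<exists>r\<ge>1. ?g a r = 1)"
    then have "{r \<in> {1..t}. f i r = 1} = {}" for t using i by auto
    then have "(\<lambda>t. real (card {r \<in> {1..t}. f i r = 1}) / real t) = (\<lambda>t. 0)" by (simp only:) simp
    moreover have "1 \<in> {1..?q}" using q_pos by simp
    then have "(\<lambda>t. real (card {r \<in> {1..t}. f i r = 1}) / real t) \<longlonglongrightarrow> 1 / real ?q"
      using f(3) i(1) unfolding balanced_def by blast
    ultimately have "(\<lambda>t::nat. 0::real) \<longlonglongrightarrow> 1 / real ?q" by (simp only:)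
    then have "1 / real ?q = 0" by (simp add: LIMSEQ_const_iff)
    then show False using q_pos by simp
  qed
  then show ?thesis using tour_complete load_le_workers by (simp add: decide_fun_iff)
qed

text \<open>The conversion by \<open>nat\<close> is harmless, as the looked-up values are at least
  1.\<close>

definition assignment :: "nat \<Rightarrow> nat \<Rightarrow> nat" where
  "assignment i r = nat (lookup_fun (construct_fun (input I), int i, int r))"

lemma assignment_correct:
  assumes "decide_fun (input I)"
  shows "balanced_feasible_assignment I assignment" "periodic I assignment (workers I)"
    "int (assignment i r) = lookup_fun (construct_fun (input I), int i, int r)"
proof -
  let ?q = "int (workers I)"
  define ks where "ks = offsets scale (rev (fst (tour scale (all_arcs scale ?q tasks))))"
  interpret int_tasks scale ?q tasks by (rule int_tasks)
  have lookup: "lookup_fun (construct_fun (input I), int i, int r)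
      = 1 + (int r - assoc_val ks (int i)) mod ?q" for i r
    by (simp add: lookup_fun_def construct_fun_def input_def Let_def ks_def scale_def)
  have res: "0 \<le> (int r - assoc_val ks (int i)) mod ?q" "(int r - assoc_val ks (int i)) mod ?q < ?q" for i r
    using q_pos by simp_all
  have int_assignment: "int (assignment i r) = 1 + (int r - assoc_val ks (int i)) mod ?q" for i r
    using res[of r i] by (simp add: assignment_def lookup)
  then show "int (assignment i r) = lookup_fun (construct_fun (input I), int i, int r)"
    by (simp add: lookup)
  have "is_assignment I assignment"
    unfolding is_assignment_def
  proof (intro ballI allI impI)
    fix i r :: nat
    have "1 \<le> int (assignment i r)" "int (assignment i r) \<le> ?q"
      using res[of r i] by (simp_all add: int_assignment)
    then show "assignment i r \<in> {1..workers I}" by simp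
  qed
  moreover have "feasible I assignment"
    unfolding feasible_def
  proof (intro ballI allI impI)
    fix i j r r' :: nat
    assume ij: "i \<in> {1..ntasks I}" "j \<in> {1..ntasks I}" "i \<noteq> j"
      and overlap: "occurrence I i r \<inter> occurrence I j r' \<noteq> {}"
    have "(int r - assoc_val ks (fst (int i, scaled_start i, scaled_finish i))) mod ?q
        \<noteq> (int r' - assoc_val ks (fst (int j, scaled_start j, scaled_finish j))) mod ?q"
      using assms ij overlap unfolding overlap_iff[OF ij(1,2)] decide_fun_iff
      by (intro offsets_disjoint[OF _ _ ks_def]) (auto simp: set_tasks)
    then have "int (assignment i r) \<noteq> int (assignment j r')" by (simp add: int_assignment)
    then show "assignment i r \<noteq> assignment j r'" by simp
  qed
  moreover have "balanced I assignment"
    unfolding balanced_def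
  proof (intro ballI)
    fix i j assume "i \<in> {1..ntasks I}" and j: "j \<in> {1..workers I}"
    have "assignment i r = j \<longleftrightarrow> (int r - assoc_val ks (int i)) mod ?q = int j - 1" for r
      using int_assignment[of i r] by linarith
    then show "(\<lambda>t. real (card {r \<in> {1..t}. assignment i r = j}) / real t) \<longlonglongrightarrow> 1 / real (workers I)"
      using residue_frequency[of ?q "int j - 1" "assoc_val ks (int i)"] j q_pos by simp
  qed
  ultimately show "balanced_feasible_assignment I assignment"
    by (simp add: balanced_feasible_assignment_def)
  have "int (assignment i r) = int (assignment i (r + workers I))" for i r
  proof -
    have "(int (r + workers I) - assoc_val ks (int i)) mod ?q
        = (int r - assoc_val ks (int i) + ?q) mod ?q" by (simp add: algebra_simps)
    then show ?thesis by (simp add: int_assignment)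
  qed
  then show "periodic I assignment (workers I)" using q_pos by (simp add: periodic_def)
qed

lemma decide_fun_correct: "decide_fun (input I) \<longleftrightarrow> (\<exists>f. balanced_feasible_assignment I f)"
  using decide_fun_complete assignment_correct(1) by blast

end

theorem theorem1p2:
  "(\<exists>(decide :: prog) (P :: nat poly). \<forall>I :: task_instance. is_instance I \<longrightarrow>
      halts_within decide (encode_instance I)
        (Num (if \<exists>f. balanced_feasible_assignment I f then 1 else 0))
        (poly P (bitsize (encode_instance I))))
   \<and>
   (\<exists>(construct :: prog) (P :: nat poly) (lookup :: prog) (Q :: nat poly).
      \<forall>I :: task_instance. is_instance I \<longrightarrow> (\<exists>f. balanced_feasible_assignment I f) \<longrightarrow>
      (\<exists>(f :: nat \<Rightarrow> nat \<Rightarrow> nat) (d :: data).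
          balanced_feasible_assignment I f \<and> periodic I f (workers I) \<and>
          halts_within construct (encode_instance I) d (poly P (bitsize (encode_instance I))) \<and>
          (\<forall>i\<in>{1..ntasks I}. \<forall>r\<ge>1.
             halts_within lookup (Join d (Join (Num (int i)) (Num (int r)))) (Num (int (f i r)))
               (poly Q (bitsize (Join d (Join (Num (int i)) (Num (int r)))))))))"
proof -
  obtain dp :: prog and DP :: "nat poly" where
    d: "\<And>x. halts_within dp (enc x) (enc (decide_fun x)) (poly DP (esize x))"
    using ptime_decide_fun unfolding ptime_def by blast
  obtain cp :: prog and CP :: "nat poly" where
    c: "\<And>x. halts_within cp (enc x) (enc (construct_fun x)) (poly CP (esize x))"
    using ptime_construct_fun unfolding ptime_def by blast
  obtain lp :: prog and LP :: "nat poly" where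
    l: "\<And>x. halts_within lp (enc x) (enc (lookup_fun x)) (poly LP (esize x))"
    using ptime_lookup_fun unfolding ptime_def by blast
  have "halts_within dp (encode_instance I)
      (Num (if \<exists>f. balanced_feasible_assignment I f then 1 else 0))
      (poly DP (bitsize (encode_instance I)))" if "is_instance I" for I
    using d[of "input I"] by (simp add: enc_input esize_def enc_bool_def decide_fun_correct[OF that])
  moreover have "\<exists>f e. balanced_feasible_assignment I f \<and> periodic I f (workers I) \<and>
      halts_within cp (encode_instance I) e (poly CP (bitsize (encode_instance I))) \<and>
      (\<forall>i\<in>{1..ntasks I}. \<forall>r\<ge>1.
         halts_within lp (Join e (Join (Num (int i)) (Num (int r)))) (Num (int (f i r)))
           (poly LP (bitsize (Join e (Join (Num (int i)) (Num (int r)))))))"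
    if I: "is_instance I" and ex: "\<exists>f. balanced_feasible_assignment I f" for I
  proof -
    have dec: "decide_fun (input I)" using ex decide_fun_correct[OF I] by simp
    have "halts_within lp (Join (enc (construct_fun (input I))) (Join (Num (int i)) (Num (int r))))
        (Num (int (assignment I i r)))
        (poly LP (bitsize (Join (enc (construct_fun (input I))) (Join (Num (int i)) (Num (int r))))))" for i r
    proof -
      have "Join (enc (construct_fun (input I))) (Join (Num (int i)) (Num (int r)))
          = enc (construct_fun (input I), int i, int r)"
        by (simp add: enc_prod_def enc_int_def)
      then show ?thesis
        using l[of "(construct_fun (input I), int i, int r)"] assignment_correct(3)[OF I dec]
        by (simp add: esize_def enc_int_def)
    qed
    then show ?thesis
      using assignment_correct(1,2)[OF I dec] c[of "input I"]
      by (intro exI[of _ "assignment I"] exI[of _ "enc (construct_fun (input I))"])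
        (simp add: enc_input esize_def)
  qed
  ultimately show ?thesis by blast
qed

end
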